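(* Let $n,k,j$ be integers with $1\le j\le k<n-1$, and let $\mathcal{T}_{n,k}\sim\nu_{n,k}$. Then $\operatorname{Link}(\{n-j+1,\dots,n\},\mathcal{T}_{n,k})$ has the same law as $\mathcal{T}_{n-j,k-j}\cup\mathcal{Y}_{k-j}(n-j,j/n)$, where $\mathcal{T}_{n-j,k-j}\sim\nu_{n-j,k-j}$ and $\mathcal{Y}_{k-j}(n-j,j/n)$ are independent.
   Context: For $m\ge1$, a $j$-face on $[m]=\{1,\dots,m\}$ is a subset of size $j+1$; a simplicial complex on $[m]$ is a nonempty family of subsets of $[m]$ closed under taking subsets. $X_j$ denotes the set of $j$-faces of $X$, and $K_m^k$ is the family of all subsets of $[m]$ of size at most $k+1$. $\mathscr{C}_{m,k}$ is the set of simplicial complexes $X$ on $[m]$ with $K_m^{k-1}\subseteq X\subseteq K_m^k$. Reduced homology $\tilde H_j(X)$ (integer coefficients, faces oriented by the order on $[m]$, with $X_{-1}=\{\emptyset\}$) has rank $\beta_j(X)$. $\mathscr{T}_{m,k}$ is the set of $X\in\mathscr{C}_{m,k}$ with $\beta_k(X)=\beta_{k-1}(X)=0$ and $|X_k|=\binom{m-1}{k}$; $\nu_{m,k}(T):=|\tilde H_{k-1}(T)|^2/m^{\binom{m-2}{k}}$ is a probability measure on $\mathscr{T}_{m,k}$. $\mathcal{Y}_{i}(m,p)$ denotes the Linial–Meshulam complex: the random element of $\mathscr{C}_{m,i}$ in which each $i$-face of $[m]$ is included independently with probability $p$. Union of two complexes in $\mathscr{C}_{m,i}$ is the union of their $i$-faces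 together with $K_m^{i-1}$. For a face $\sigma$ of a complex $X$ on $[n]$, $\operatorname{Link}(\sigma,X):=\{\tau\subseteq[n]\setminus\sigma:\tau\cup\sigma\in X\}$; for $\sigma=\{n-j+1,\dots,n\}$ this is regarded as a complex on $[n-j]$. *)

theory Defs
  imports "HOL-Probability.Probability" "HOL-Algebra.Free_Abelian_Groups"
begin

section \<open>Simplicial complexes on \<open>{1..m}\<close>\<close>

text \<open>
  Dimensions are integers, so that dimensions -1 and -2 need no special treatment: the empty set
  is the only face of dimension -1, and there are no faces of dimension below -1.
\<close>

definition simplicial_complex :: "nat \<Rightarrow> nat set set \<Rightarrow> bool" where
  "simplicial_complex m X \<longleftrightarrow>
     X \<noteq> {} \<and> (\<forall>\<sigma>\<in>X. \<sigma> \<subseteq> {1..m}) \<and> (\<forall>\<sigma>\<in>X. \<forall>\<tau>. \<tau> \<subseteq> \<sigma> \<longrightarrow> \<tau> \<in> X)"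

definition faces :: "int \<Rightarrow> nat set set \<Rightarrow> nat set set" where
  "faces j X = {\<sigma> \<in> X. int (card \<sigma>) = j + 1}"

definition full_skeleton :: "nat \<Rightarrow> int \<Rightarrow> nat set set" where
  "full_skeleton m k = {\<sigma>. \<sigma> \<subseteq> {1..m} \<and> int (card \<sigma>) \<le> k + 1}"

definition complexes :: "nat \<Rightarrow> nat \<Rightarrow> nat set set set" where
  "complexes m k =
     {X. simplicial_complex m X \<and>
         full_skeleton m (int k - 1) \<subseteq> X \<and> X \<subseteq> full_skeleton m (int k)}"

definition complex_union :: "nat \<Rightarrow> nat \<Rightarrow> nat set set \<Rightarrow> nat set set \<Rightarrow> nat set set" where
  "complex_union m i X Y = full_skeleton m (int i - 1) \<union> (faces (int i) X \<union> faces (int i) Y)"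

definition Link :: "nat \<Rightarrow> nat set \<Rightarrow> nat set set \<Rightarrow> nat set set" where
  "Link n \<sigma> X = {\<tau>. \<tau> \<subseteq> {1..n} - \<sigma> \<and> \<tau> \<union> \<sigma> \<in> X}"


section \<open>Reduced simplicial homology\<close>

definition face_chain_group :: "int \<Rightarrow> nat set set \<Rightarrow> (nat set \<Rightarrow>\<^sub>0 int) monoid" where
  "face_chain_group j X = free_Abelian_group (faces j X)"

text \<open>
  The sign of \<open>\<sigma> - {v}\<close> is determined by the position of \<open>v\<close> in the increasing enumeration of
  \<open>\<sigma>\<close>. On the (-1)-dimensional chains this map is zero, and on vertices it is the augmentation.
\<close>

definition face_boundary :: "(nat set \<Rightarrow>\<^sub>0 int) \<Rightarrow> (nat set \<Rightarrow>\<^sub>0 int)" where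
  "face_boundary =
     frag_extend (\<lambda>\<sigma>. \<Sum>v\<in>\<sigma>. frag_cmul ((-1) ^ card {u \<in> \<sigma>. u < v}) (frag_of (\<sigma> - {v})))"

definition reduced_cycles :: "int \<Rightarrow> nat set set \<Rightarrow> (nat set \<Rightarrow>\<^sub>0 int) set" where
  "reduced_cycles j X =
     kernel (face_chain_group j X) (face_chain_group (j - 1) X) face_boundary"

definition reduced_boundaries :: "int \<Rightarrow> nat set set \<Rightarrow> (nat set \<Rightarrow>\<^sub>0 int) set" where
  "reduced_boundaries j X = face_boundary ` carrier (face_chain_group (j + 1) X)"

definition reduced_homology :: "int \<Rightarrow> nat set set \<Rightarrow> (nat set \<Rightarrow>\<^sub>0 int) set monoid" where
  "reduced_homology j X =
     subgroup_generated (face_chain_group j X) (reduced_cycles j X) Mod reduced_boundaries j X"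

definition int_independent :: "('a, 'b) monoid_scheme \<Rightarrow> 'a set \<Rightarrow> bool" where
  "int_independent G S \<longleftrightarrow>
     S \<subseteq> carrier G \<and> finite S \<and>
     (\<forall>c :: 'a \<Rightarrow> int. finprod G (\<lambda>s. s [^]\<^bsub>G\<^esub> c s) S = \<one>\<^bsub>G\<^esub> \<longrightarrow> (\<forall>s\<in>S. c s = 0))"

text \<open>
  The rank of a finitely generated abelian group. The supremum is taken in the natural numbers,
  so the definition is only meaningful when the rank is finite.
\<close>

definition abelian_rank :: "('a, 'b) monoid_scheme \<Rightarrow> nat" where
  "abelian_rank G = Sup (card ` {S. int_independent G S})"

definition betti :: "int \<Rightarrow> nat set set \<Rightarrow> nat" where
  "betti j X = abelian_rank (reduced_homology j X)"


section \<open>Random complexes\<close>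

definition hypertrees :: "nat \<Rightarrow> nat \<Rightarrow> nat set set set" where
  "hypertrees m k =
     {X \<in> complexes m k. betti (int k) X = 0 \<and> betti (int k - 1) X = 0 \<and>
        card (faces (int k) X) = (m - 1) choose k}"

definition hypertree_measure :: "nat \<Rightarrow> nat \<Rightarrow> nat set set measure" where
  "hypertree_measure m k =
     point_measure (hypertrees m k)
       (\<lambda>T. ennreal (real (order (reduced_homology (int k - 1) T)) ^ 2
                       / real m ^ ((m - 2) choose k)))"

text \<open>For \<open>p\<close> outside \<open>[0, 1]\<close>, \<^const>\<open>bernoulli_pmf\<close> truncates \<open>p\<close> to that interval.\<close>

definition linial_meshulam :: "nat \<Rightarrow> nat \<Rightarrow> real \<Rightarrow> nat set set pmf" where
  "linial_meshulam m i p =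
     map_pmf
       (\<lambda>included. full_skeleton m (int i - 1) \<union>
                   {\<sigma> \<in> faces (int i) (Pow {1..m}). included \<sigma>})
       (Pi_pmf (faces (int i) (Pow {1..m})) False (\<lambda>_. bernoulli_pmf p))"

definition has_law :: "'a measure \<Rightarrow> ('a \<Rightarrow> 'b) \<Rightarrow> 'b measure \<Rightarrow> bool" where
  "has_law M X P \<longleftrightarrow> X \<in> measurable M P \<and> distr M P X = P"

end

(*
  Deleting the row of the last vertex from the boundary matrix between the (k-1)-faces and the
  k-faces gives a matrix A whose maximal minor with column set T is, up to sign, the order of
  H_{k-1} of the complex with k-faces T (0 when that group is infinite). By Cauchy-Binet, the
  probability that all k-faces of the random hypertree lie in a family K is therefore proportional
  to det(A_K A_K^T).

  The law of a random subfamily F of a finite set is determined by the probabilities P(F <= L).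
  For the link of the vertex n, the event "link <= L" is "faces of T lie in K", where K consists
  of the faces avoiding n and the cones over L. Its Gram matrix is 1_L + D D^T, where D is the
  unreduced boundary matrix on [n-1], and D D^T is (n-1) times the orthogonal projection onto the
  complement of the row space of the next lower boundary matrix. A basis adapted to this splitting
  turns the determinant into a constant times ((n-1)/n)^{#complement of L} times the corresponding
  Gram determinant in dimension k-1, which is the product of the two probabilities for the
  hypertree and for the Linial-Meshulam complex. Iterating j times multiplies the factors
  (n-1)/n, (n-2)/(n-1), ..., to (n-j)/n. Normalising constants cancel throughout, so
  Kalai's formula for the total weight is never needed.
*)

theory Submission
  imports Defs "HOL-Algebra.Multiplicative_Group"
begin

section \<open>Determinants over finite index sets\<close>

text \<open>Write \<open>m\<close> for the number of vertices left after deleting one, so that the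
  Gram matrix is \<open>1_L + D D\<^sup>T\<close> on \<open>m\<close> vertices. The obstacle is that
  the indicator of \<open>L\<close> does not respect the splitting, so this matrix is not diagonal
  in the adapted basis. What holds is weaker but sufficient: on the rows of the next lower boundary
  matrix, \<open>D D\<^sup>T\<close> vanishes and the indicator deletes the columns outside
  \<open>L\<close>; on the columns of \<open>D\<close>, an entry is multiplied by \<open>m\<close>,
  or by \<open>m + 1\<close> at a face of \<open>L\<close>. Scaling rows of the first kind by
  \<open>m + 1\<close> gives both kinds the same column factors, the origin of the powers in the
  result. Pairing what remains with the basis matrix gives a block-triangular matrix, one of whose
  blocks is the Gram matrix one dimension lower. No basis matrix is inverted: the identity is
  multiplied by its determinant and a positive Gram determinant is cancelled, so all matrices stay
  integral. They are indexed by faces without any ordering.\<close>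

definition det_on :: "'a set \<Rightarrow> ('a \<Rightarrow> 'a \<Rightarrow> int) \<Rightarrow> int" where
  "det_on S A = (\<Sum>p | p permutes S. sign p * (\<Prod>i\<in>S. A i (p i)))"

lemma det_on_cong:
  assumes "\<And>i j. i \<in> S \<Longrightarrow> j \<in> S \<Longrightarrow> A i j = B i j"
  shows "det_on S A = det_on S B"
  unfolding det_on_def
  by (intro sum.cong refl arg_cong2[of _ _ _ _ "(*)"] prod.cong) (auto simp: assms permutes_in_image)

lemma det_on_empty [simp]: "det_on {} A = 1"
  by (simp add: det_on_def sign_id)

lemma det_on_permute_rows:
  assumes "finite S" "q permutes S"
  shows "det_on S (\<lambda>i. A (q i)) = sign q * det_on S A"
proof -
  have "det_on S (\<lambda>i. A (q i)) = (\<Sum>p | p permutes S. sign (p \<circ> q) * (\<Prod>i\<in>S. A (q i) ((p \<circ> q) i)))"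
    unfolding det_on_def by (rule sum_permutations_compose_right[OF assms(2)])
  also have "\<dots> = (\<Sum>p | p permutes S. sign q * (sign p * (\<Prod>i\<in>S. A i (p i))))"
  proof (intro sum.cong refl)
    fix p assume "p \<in> {p. p permutes S}"
    then have p: "p permutes S" by simp
    have "(\<Prod>i\<in>S. A (q i) ((p \<circ> q) i)) = (\<Prod>i\<in>S. A i (p i))"
      using prod.permute[OF assms(2), of "\<lambda>i. A i (p i)"] by (simp add: o_def)
    moreover have "sign (p \<circ> q) = sign p * sign q"
      using assms p by (intro sign_compose) (auto intro: permutation_permutes[THEN iffD2])
    ultimately show "sign (p \<circ> q) * (\<Prod>i\<in>S. A (q i) ((p \<circ> q) i)) =
        sign q * (sign p * (\<Prod>i\<in>S. A i (p i)))"
      by (simp add: mult_ac)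
  qed
  finally show ?thesis
    by (simp add: det_on_def sum_distrib_left)
qed

lemma det_on_identical_rows:
  assumes "finite S" "a \<in> S" "b \<in> S" "a \<noteq> b" "\<And>j. j \<in> S \<Longrightarrow> A a j = A b j"
  shows "det_on S A = 0"
proof -
  have "det_on S A = det_on S (\<lambda>i. A (Transposition.transpose a b i))"
    by (rule det_on_cong) (auto simp: Transposition.transpose_def assms)
  also have "\<dots> = - det_on S A"
    using det_on_permute_rows[OF assms(1) permutes_swap_id[OF assms(2,3)], of A] assms(4)
    by (simp add: sign_swap_id)
  finally show ?thesis by simp
qed

lemma det_on_transpose:
  assumes "finite S"
  shows "det_on S (\<lambda>i j. A j i) = det_on S A"
proof -
  have "det_on S (\<lambda>i j. A j i) = (\<Sum>p | p permutes S. sign (inv_into UNIV p) * (\<Prod>i\<in>S. A (inv_into UNIV p i) i))"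
    unfolding det_on_def by (rule sum_permutations_inverse)
  also have "\<dots> = det_on S A"
    unfolding det_on_def
  proof (intro sum.cong refl)
    fix p assume "p \<in> {p. p permutes S}"
    then have p: "p permutes S" by simp
    have "(\<Prod>i\<in>S. A (inv_into UNIV p i) i) = (\<Prod>i\<in>S. A i (p i))"
      using prod.permute[OF p, of "\<lambda>i. A (inv_into UNIV p i) i"] p by (simp add: o_def permutes_inverses)
    moreover have "sign (inv_into UNIV p) = sign p"
      using assms p by (intro sign_inverse) (auto intro: permutation_permutes[THEN iffD2])
    ultimately show "sign (inv_into UNIV p) * (\<Prod>i\<in>S. A (inv_into UNIV p i) i) = sign p * (\<Prod>i\<in>S. A i (p i))"
      by simp
  qed
  finally show ?thesis .
qed

text \<open>Expanding the product of the row sums gives one term for every map \<open>f\<close> from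
  \<open>S\<close> to \<open>E\<close>; a map that is not injective repeats a row of
  \<open>B\<close> and contributes 0. With \<open>E = S\<close> this yields multiplicativity, with
  larger \<open>E\<close> the Cauchy-Binet formula.\<close>

lemma det_on_mult_expand:
  assumes "finite S" "finite E"
  shows "det_on S (\<lambda>i j. \<Sum>e\<in>E. A i e * B e j) =
    (\<Sum>f | f \<in> S \<rightarrow>\<^sub>E E \<and> inj_on f S. (\<Prod>i\<in>S. A i (f i)) * det_on S (\<lambda>i. B (f i)))"
proof -
  have "det_on S (\<lambda>i j. \<Sum>e\<in>E. A i e * B e j) =
     (\<Sum>p | p permutes S. \<Sum>f\<in>S \<rightarrow>\<^sub>E E. sign p * (\<Prod>i\<in>S. A i (f i) * B (f i) (p i)))"
    unfolding det_on_def using assms by (simp add: prod_sum_PiE sum_distrib_left)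
  also have "\<dots> = (\<Sum>f\<in>S \<rightarrow>\<^sub>E E. \<Sum>p | p permutes S. sign p * (\<Prod>i\<in>S. A i (f i) * B (f i) (p i)))"
    by (rule sum.swap)
  also have "\<dots> = (\<Sum>f\<in>S \<rightarrow>\<^sub>E E. (\<Prod>i\<in>S. A i (f i)) * det_on S (\<lambda>i. B (f i)))"
    unfolding det_on_def by (simp add: prod.distrib sum_distrib_left mult_ac)
  also have "\<dots> = (\<Sum>f | f \<in> S \<rightarrow>\<^sub>E E \<and> inj_on f S. (\<Prod>i\<in>S. A i (f i)) * det_on S (\<lambda>i. B (f i)))"
  proof (rule sum.mono_neutral_right)
    show "finite (S \<rightarrow>\<^sub>E E)" using assms by (intro finite_PiE) auto
    show "\<forall>f\<in>(S \<rightarrow>\<^sub>E E) - {f \<in> S \<rightarrow>\<^sub>E E. inj_on f S}. (\<Prod>i\<in>S. A i (f i)) * det_on S (\<lambda>i. B (f i)) = 0"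
    proof
      fix f assume "f \<in> (S \<rightarrow>\<^sub>E E) - {f \<in> S \<rightarrow>\<^sub>E E. inj_on f S}"
      then obtain a b where "a \<in> S" "b \<in> S" "a \<noteq> b" "f a = f b"
        unfolding inj_on_def by blast
      then have "det_on S (\<lambda>i. B (f i)) = 0"
        using assms(1) by (intro det_on_identical_rows[of S a b]) auto
      then show "(\<Prod>i\<in>S. A i (f i)) * det_on S (\<lambda>i. B (f i)) = 0" by simp
    qed
  qed auto
  finally show ?thesis .
qed

text \<open>Permutations are the identity outside \<open>S\<close>, whereas members of a
  \<open>PiE\<close> set are \<open>undefined\<close> there; this bridges the two
  conventions.\<close>

lemma bij_betw_permutes_restrict:
  assumes "finite S"
  shows "bij_betw (\<lambda>p. restrict p S) {p. p permutes S} {f. f \<in> S \<rightarrow>\<^sub>E S \<and> inj_on f S}"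
proof (rule bij_betw_byWitness[where f' = "\<lambda>f i. if i \<in> S then f i else i"])
  show "\<forall>p\<in>{p. p permutes S}. (\<lambda>i. if i \<in> S then restrict p S i else i) = p"
    by (auto simp: permutes_not_in)
  show "\<forall>f\<in>{f. f \<in> S \<rightarrow>\<^sub>E S \<and> inj_on f S}. restrict (\<lambda>i. if i \<in> S then f i else i) S = f"
    by (auto intro!: ext simp: PiE_def extensional_def)
  show "(\<lambda>p. restrict p S) ` {p. p permutes S} \<subseteq> {f. f \<in> S \<rightarrow>\<^sub>E S \<and> inj_on f S}"
    by (auto simp: permutes_in_image inj_on_restrict_eq intro: permutes_inj_on)
  show "(\<lambda>f i. if i \<in> S then f i else i) ` {f. f \<in> S \<rightarrow>\<^sub>E S \<and> inj_on f S} \<subseteq> {p. p permutes S}"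
  proof safe
    fix f assume f: "f \<in> S \<rightarrow>\<^sub>E S" "inj_on f S"
    then have "bij_betw f S S"
      using assms by (simp add: bij_betw_def endo_inj_surj image_subset_iff_funcset PiE_iff Pi_def)
    then have "bij_betw (\<lambda>i. if i \<in> S then f i else i) S S"
      by (rule bij_betw_cong[THEN iffD1, rotated]) auto
    then show "(\<lambda>i. if i \<in> S then f i else i) permutes S"
      by (rule bij_imp_permutes) auto
  qed
qed

lemma det_on_mult:
  assumes "finite S"
  shows "det_on S (\<lambda>i j. \<Sum>l\<in>S. A i l * B l j) = det_on S A * det_on S B"
proof -
  have "det_on S (\<lambda>i j. \<Sum>l\<in>S. A i l * B l j) =
      (\<Sum>f | f \<in> S \<rightarrow>\<^sub>E S \<and> inj_on f S. (\<Prod>i\<in>S. A i (f i)) * det_on S (\<lambda>i. B (f i)))"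
    by (rule det_on_mult_expand) (use assms in auto)
  also have "\<dots> = (\<Sum>p | p permutes S. (\<Prod>i\<in>S. A i (restrict p S i)) * det_on S (\<lambda>i. B (restrict p S i)))"
    by (rule sum.reindex_bij_betw[OF bij_betw_permutes_restrict[OF assms], symmetric])
  also have "\<dots> = (\<Sum>p | p permutes S. (\<Prod>i\<in>S. A i (p i)) * det_on S (\<lambda>i. B (p i)))"
  proof (intro sum.cong refl)
    fix p
    have "(\<Prod>i\<in>S. A i (restrict p S i)) = (\<Prod>i\<in>S. A i (p i))"
      by (rule prod.cong) auto
    moreover have "det_on S (\<lambda>i. B (restrict p S i)) = det_on S (\<lambda>i. B (p i))"
      by (rule det_on_cong) auto
    ultimately show "(\<Prod>i\<in>S. A i (restrict p S i)) * det_on S (\<lambda>i. B (restrict p S i)) =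
        (\<Prod>i\<in>S. A i (p i)) * det_on S (\<lambda>i. B (p i))"
      by simp
  qed
  also have "\<dots> = (\<Sum>p | p permutes S. sign p * (\<Prod>i\<in>S. A i (p i)) * det_on S B)"
    by (intro sum.cong refl) (simp add: det_on_permute_rows[OF assms] mult_ac)
  finally show ?thesis by (simp add: det_on_def sum_distrib_right)
qed

lemma det_on_reindex:
  assumes "finite S" "bij_betw f S S'"
  shows "det_on S' A = det_on S (\<lambda>i j. A (f i) (f j))"
proof -
  have inj: "inj_on f S" and img: "f ` S = S'"
    using assms(2) by (auto simp: bij_betw_def)
  let ?m = "map_permutation S f"
  have "map_permutation S f = (\<lambda>p x. if x \<in> S' then f (p (inv_into S f x)) else x)"
    unfolding map_permutation_def restrict_id_def img o_def by (rule refl)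
  then have bij: "bij_betw ?m {p. p permutes S} {p. p permutes S'}"
    using bij_betw_permutations[OF assms(2)] by (simp only:)
  have "det_on S' A = (\<Sum>p | p permutes S. sign (?m p) * (\<Prod>i\<in>S'. A i (?m p i)))"
    unfolding det_on_def by (rule sum.reindex_bij_betw[OF bij, symmetric])
  also have "\<dots> = (\<Sum>p | p permutes S. sign p * (\<Prod>i\<in>S. A (f i) (f (p i))))"
  proof (intro sum.cong refl)
    fix p assume "p \<in> {p. p permutes S}"
    then have p: "p permutes S" by simp
    have "(\<Prod>i\<in>S'. A i (?m p i)) = (\<Prod>i\<in>S. A (f i) (?m p (f i)))"
      by (rule prod.reindex_bij_betw[OF assms(2), symmetric])
    then show "sign (?m p) * (\<Prod>i\<in>S'. A i (?m p i)) = sign p * (\<Prod>i\<in>S. A (f i) (f (p i)))"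
      by (simp add: sign_map_permutation[OF inj p assms(1)] map_permutation_apply[OF inj])
  qed
  finally show ?thesis by (simp add: det_on_def)
qed

text \<open>A permutation that moves \<open>s\<close> picks up one of the zero entries of row
  \<open>s\<close>, so only the permutations of \<open>S\<close> survive in the Leibniz sum.\<close>

lemma det_on_insert_row:
  assumes "finite S" "s \<notin> S" "\<And>j. j \<in> S \<Longrightarrow> A s j = 0"
  shows "det_on (insert s S) A = A s s * det_on S A"
proof -
  have "det_on (insert s S) A =
      (\<Sum>p | p permutes S. sign p * (\<Prod>i\<in>insert s S. A i (p i)))"
    unfolding det_on_def
  proof (rule sum.mono_neutral_right)
    show "finite {p. p permutes insert s S}" using assms(1) by (intro finite_permutations) auto
    show "{p. p permutes S} \<subseteq> {p. p permutes insert s S}"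
      by (auto intro: permutes_subset)
    show "\<forall>p\<in>{p. p permutes insert s S} - {p. p permutes S}. sign p * (\<Prod>i\<in>insert s S. A i (p i)) = 0"
    proof
      fix p assume "p \<in> {p. p permutes insert s S} - {p. p permutes S}"
      then have p: "p permutes insert s S" "\<not> p permutes S" by auto
      have "p s \<noteq> s"
      proof
        assume "p s = s"
        then have "p permutes S"
          by (intro permutes_superset[OF p(1)]) auto
        then show False using p(2) by simp
      qed
      then have "p s \<in> S" using p(1) permutes_in_image[OF p(1), of s] by auto
      then have "A s (p s) = 0" by (rule assms(3))
      then have "(\<Prod>i\<in>insert s S. A i (p i)) = 0"
        using assms(1) by (intro prod_zero) auto
      then show "sign p * (\<Prod>i\<in>insert s S. A i (p i)) = 0" by simp
    qed
  qed
  also have "\<dots> = (\<Sum>p | p permutes S. A s s * (sign p * (\<Prod>i\<in>S. A i (p i))))"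
  proof (intro sum.cong refl)
    fix p assume "p \<in> {p. p permutes S}"
    then have "p s = s" using permutes_not_in assms(2) by fastforce
    then show "sign p * (\<Prod>i\<in>insert s S. A i (p i)) = A s s * (sign p * (\<Prod>i\<in>S. A i (p i)))"
      using assms(1,2) by simp
  qed
  finally show ?thesis by (simp add: det_on_def sum_distrib_left)
qed

lemma det_on_insert_column:
  assumes "finite S" "s \<notin> S" "\<And>i. i \<in> S \<Longrightarrow> A i s = 0"
  shows "det_on (insert s S) A = A s s * det_on S A"
  using det_on_insert_row[of S s "\<lambda>i j. A j i"] assms
    det_on_transpose[of S A] det_on_transpose[of "insert s S" A]
  by simp

lemma det_on_diagonal:
  assumes "finite S" "\<And>i j. i \<in> S \<Longrightarrow> j \<in> S \<Longrightarrow> i \<noteq> j \<Longrightarrow> A i j = 0"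
  shows "det_on S A = (\<Prod>i\<in>S. A i i)"
  using assms
proof (induction S)
  case (insert s S)
  then show ?case
    by (subst det_on_insert_row) auto
qed simp

text \<open>The block-triangular matrix is the product of two matrices that agree with the identity
  matrix on one of the two blocks of rows.\<close>

lemma det_on_block:
  assumes "finite R" "finite S" "R \<inter> S = {}" "\<And>i j. i \<in> S \<Longrightarrow> j \<in> R \<Longrightarrow> A i j = 0"
  shows "det_on (R \<union> S) A = det_on R A * det_on S A"
proof -
  have id_rows: "det_on (P \<union> Q) C = det_on P C"
    if "finite P" "finite Q" "P \<inter> Q = {}" "\<And>i j. i \<in> Q \<Longrightarrow> j \<in> P \<union> Q \<Longrightarrow> C i j = (if i = j then 1 else 0)"
    for P Q :: "'a set" and C :: "'a \<Rightarrow> 'a \<Rightarrow> int"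
    using that(2,1,3-)
  proof (induction Q)
    case (insert s Q)
    have "det_on (insert s (P \<union> Q)) C = C s s * det_on (P \<union> Q) C"
      by (rule det_on_insert_row) (use insert in auto)
    then show ?case using insert by auto
  qed simp
  define C where "C i j = (if i \<in> S then A i j else if i = j then 1 else 0)" for i j
  define D where "D i j = (if i \<in> R then A i j else if i = j then 1 else 0)" for i j
  have "det_on (R \<union> S) A = det_on (R \<union> S) (\<lambda>i j. \<Sum>l\<in>R \<union> S. C i l * D l j)"
  proof (rule det_on_cong)
    fix i j assume ij: "i \<in> R \<union> S" "j \<in> R \<union> S"
    show "A i j = (\<Sum>l\<in>R \<union> S. C i l * D l j)"
    proof (cases "i \<in> S")
      case True
      have "(\<Sum>l\<in>R \<union> S. C i l * D l j) = (\<Sum>l\<in>S. A i l * (if l = j then 1 else 0))"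
        using assms True by (intro sum.mono_neutral_cong_right) (auto simp: C_def D_def)
      also have "\<dots> = A i j"
        using assms(2) ij assms(4)[OF True, of j] by (simp add: if_distrib cong: if_cong) auto
      finally show ?thesis by simp
    next
      case False
      then have i: "i \<in> R" using ij by auto
      have "(\<Sum>l\<in>R \<union> S. C i l * D l j) = (\<Sum>l\<in>{i}. D l j)"
        using assms(1,2) False i by (intro sum.mono_neutral_cong_right) (auto simp: C_def)
      then show ?thesis using i by (simp add: D_def)
    qed
  qed
  also have "\<dots> = det_on (R \<union> S) C * det_on (R \<union> S) D"
    by (rule det_on_mult) (use assms in auto)
  also have "det_on (R \<union> S) C = det_on S C"
    unfolding Un_commute[of R] by (rule id_rows) (use assms in \<open>auto simp: C_def\<close>)
  also have "det_on (R \<union> S) D = det_on R D"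
    by (rule id_rows) (use assms in \<open>auto simp: D_def\<close>)
  also have "det_on S C = det_on S A" by (rule det_on_cong) (auto simp: C_def)
  also have "det_on R D = det_on R A" by (rule det_on_cong) (auto simp: D_def)
  finally show ?thesis by simp
qed

text \<open>The modified matrix is \<open>A\<close> multiplied on the left by the identity matrix
  with row \<open>s\<close> replaced by \<open>a\<close>, and that factor has determinant
  \<open>a s\<close>.\<close>

lemma det_on_row_sum:
  assumes "finite S" "s \<in> S"
  shows "det_on S (A(s := \<lambda>j. \<Sum>l\<in>S. a l * A l j)) = a s * det_on S A" (is "?L = _")
proof -
  define C where "C i l = (if i = s then a l else if i = l then 1 else 0)" for i l
  have "?L = det_on S (\<lambda>i j. \<Sum>l\<in>S. C i l * A l j)"
  proof (rule det_on_cong)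
    fix i j assume ij: "i \<in> S" "j \<in> S"
    show "(A(s := \<lambda>j. \<Sum>l\<in>S. a l * A l j)) i j = (\<Sum>l\<in>S. C i l * A l j)"
    proof (cases "i = s")
      case False
      then have "(\<Sum>l\<in>S. C i l * A l j) = (\<Sum>l\<in>S. if l = i then A i j else 0)"
        by (intro sum.cong) (auto simp: C_def)
      then show ?thesis using False ij assms by simp
    qed (simp add: C_def)
  qed
  also have "\<dots> = det_on S C * det_on S A"
    by (rule det_on_mult) (use assms in auto)
  also have "det_on S C = det_on (insert s (S - {s})) C" using assms by (simp add: insert_absorb)
  also have "\<dots> = C s s * det_on (S - {s}) C"
    by (rule det_on_insert_column) (use assms in \<open>auto simp: C_def\<close>)
  also have "det_on (S - {s}) C = (\<Prod>i\<in>S - {s}. C i i)"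
    by (rule det_on_diagonal) (use assms in \<open>auto simp: C_def\<close>)
  also have "\<dots> = 1" by (rule prod.neutral) (auto simp: C_def)
  also have "C s s * 1 = a s" by (simp add: C_def)
  finally show ?thesis .
qed

lemma det_on_add_row:
  assumes "finite S" "s \<in> S" "r \<in> S" "r \<noteq> s"
  shows "det_on S (A(s := \<lambda>j. A s j + c * A r j)) = det_on S A"
proof -
  define a where "a l = (if l = s then 1 else if l = r then c else 0)" for l
  have "(\<Sum>l\<in>S. a l * A l j) = A s j + c * A r j" for j
  proof -
    have "(\<Sum>l\<in>S. a l * A l j) = (\<Sum>l\<in>{s, r}. a l * A l j)"
      using assms by (intro sum.mono_neutral_right) (auto simp: a_def)
    then show ?thesis using assms(4) by (simp add: a_def)
  qed
  then show ?thesis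
    using det_on_row_sum[OF assms(1,2), of A a] by (simp add: a_def)
qed

text \<open>Row \<open>s\<close> is replaced by the zero row. Seen as the combination with
  coefficients \<open>a\<close>, this gives \<open>a s * det_on S A\<close>; seen as the trivial
  combination, it gives 0.\<close>

lemma det_on_eq_0_if_dependent:
  assumes "finite S" "s \<in> S" "a s \<noteq> 0" "\<And>j. j \<in> S \<Longrightarrow> (\<Sum>l\<in>S. a l * A l j) = 0"
  shows "det_on S A = 0"
proof -
  have "a s * det_on S A = det_on S (A(s := \<lambda>j. \<Sum>l\<in>S. a l * A l j))"
    by (rule det_on_row_sum[symmetric]) fact+
  also have "\<dots> = det_on S (A(s := \<lambda>j. \<Sum>l\<in>S. 0 * A l j))"
    by (rule det_on_cong) (use assms(4) in auto)
  also have "\<dots> = 0 * det_on S A"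
    by (rule det_on_row_sum) fact+
  finally show ?thesis using assms(3) by simp
qed

section \<open>Gram determinants and the Cauchy-Binet formula\<close>

definition gram_det :: "'a set \<Rightarrow> ('a \<Rightarrow> 'e \<Rightarrow> int) \<Rightarrow> 'e set \<Rightarrow> int" where
  "gram_det S A E = det_on S (\<lambda>i j. \<Sum>e\<in>E. A i e * A j e)"

text \<open>Cauchy-Binet with each squared minor kept as a Gram determinant, so that no bijection
  between \<open>S\<close> and \<open>T\<close> has to be chosen. Grouping the injections of the
  expansion by their image works because an injection into a set of size \<open>card S\<close> is
  onto.\<close>

lemma gram_det_eq_sum:
  assumes "finite S" "finite E"
  shows "gram_det S A E = (\<Sum>T | T \<subseteq> E \<and> card T = card S. gram_det S A T)"
proof -
  let ?g = "\<lambda>f. (\<Prod>i\<in>S. A i (f i)) * det_on S (\<lambda>i j. A j (f i))"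
  have expand: "gram_det S A T = (\<Sum>f | f \<in> S \<rightarrow>\<^sub>E T \<and> inj_on f S. ?g f)" if "finite T" for T
    unfolding gram_det_def by (rule det_on_mult_expand) (use assms that in auto)
  have image: "f ` S = T \<longleftrightarrow> f ` S \<subseteq> T" if "inj_on f S" "finite T" "card T = card S" for f T
    using that by (metis card_image card_subset_eq order_refl)
  have "gram_det S A E = (\<Sum>f | f \<in> S \<rightarrow>\<^sub>E E \<and> inj_on f S. ?g f)"
    by (rule expand) fact
  also have "\<dots> = (\<Sum>T | T \<subseteq> E \<and> card T = card S.
      \<Sum>f | f \<in> {f. f \<in> S \<rightarrow>\<^sub>E E \<and> inj_on f S} \<and> f ` S = T. ?g f)"
    using assms
    by (intro sum.group[symmetric]) (auto simp: card_image intro!: finite_PiE)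
  also have "\<dots> = (\<Sum>T | T \<subseteq> E \<and> card T = card S. gram_det S A T)"
  proof (intro sum.cong refl)
    fix T assume "T \<in> {T. T \<subseteq> E \<and> card T = card S}"
    then have T: "T \<subseteq> E" "card T = card S" "finite T"
      using assms(2) finite_subset by auto
    have "{f. f \<in> {f. f \<in> S \<rightarrow>\<^sub>E E \<and> inj_on f S} \<and> f ` S = T} = {f. f \<in> S \<rightarrow>\<^sub>E T \<and> inj_on f S}"
      using T image by (auto simp: PiE_iff image_subset_iff)
    then show "(\<Sum>f | f \<in> {f. f \<in> S \<rightarrow>\<^sub>E E \<and> inj_on f S} \<and> f ` S = T. ?g f) = gram_det S A T"
      using expand[OF T(3)] by simp
  qed
  finally show ?thesis .
qed

lemma gram_det_bij:
  assumes "finite S" "bij_betw f S T"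
  shows "gram_det S A T = (det_on S (\<lambda>i j. A j (f i)))\<^sup>2"
proof -
  have "gram_det S A T = det_on S (\<lambda>i j. \<Sum>l\<in>S. A i (f l) * A j (f l))"
    unfolding gram_det_def
    by (intro det_on_cong sum.reindex_bij_betw[OF assms(2), symmetric])
  also have "\<dots> = det_on S (\<lambda>i l. A i (f l)) * det_on S (\<lambda>l j. A j (f l))"
    by (rule det_on_mult) fact
  finally show ?thesis
    using det_on_transpose[OF assms(1), of "\<lambda>l j. A j (f l)"] by (simp add: power2_eq_square)
qed

lemma gram_det_nonneg:
  assumes "finite S" "finite T" "card T = card S"
  shows "gram_det S A T \<ge> 0"
proof -
  obtain f where "bij_betw f S T"
    using assms finite_same_card_bij by metis
  from gram_det_bij[OF assms(1) this, of A] show ?thesis by simp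
qed

text \<open>All summands of the Cauchy-Binet sum are squares, so a single nonzero maximal minor,
  here with the image of \<open>f\<close> as columns, forces positivity.\<close>

lemma gram_det_pos:
  assumes "finite S" "finite E" "inj_on f S" "f ` S \<subseteq> E" "det_on S (\<lambda>i j. A j (f i)) \<noteq> 0"
  shows "gram_det S A E > 0"
proof -
  have "0 < (det_on S (\<lambda>i j. A j (f i)))\<^sup>2" using assms(5) by simp
  also have "\<dots> = gram_det S A (f ` S)"
    by (rule gram_det_bij[symmetric]) (use assms in \<open>auto simp: bij_betw_def\<close>)
  also have "\<dots> \<le> gram_det S A E"
    unfolding gram_det_eq_sum[OF assms(1,2)]
  proof (rule member_le_sum)
    show "f ` S \<in> {T. T \<subseteq> E \<and> card T = card S}"
      using assms by (simp add: card_image)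
    show "0 \<le> gram_det S A T" if "T \<in> {T. T \<subseteq> E \<and> card T = card S} - {f ` S}" for T
      using that assms finite_subset by (intro gram_det_nonneg) auto
    show "finite {T. T \<subseteq> E \<and> card T = card S}" using assms(2) by auto
  qed
  finally show ?thesis .
qed

section \<open>The index of a lattice\<close>

text \<open>Spelled with \<open>b + z\<close> to agree with the right cosets that make up the
  carrier of a quotient group.\<close>

definition cosets :: "'g::ab_group_add set \<Rightarrow> 'g set \<Rightarrow> 'g set set" where
  "cosets Z B = (\<lambda>z. (\<lambda>b. b + z) ` B) ` Z"

definition add_subgroup :: "'g::ab_group_add set \<Rightarrow> bool" where
  "add_subgroup B \<longleftrightarrow> 0 \<in> B \<and> (\<forall>x\<in>B. \<forall>y\<in>B. x - y \<in> B)"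

lemma add_subgroup_add:
  assumes "add_subgroup B" "x \<in> B" "y \<in> B"
  shows "x + y \<in> B"
proof -
  have "x - (0 - y) \<in> B" using assms unfolding add_subgroup_def by blast
  then show ?thesis by simp
qed

lemma coset_eq_iff:
  assumes "add_subgroup B"
  shows "(\<lambda>b. b + z) ` B = (\<lambda>b. b + z') ` B \<longleftrightarrow> z - z' \<in> B"
proof
  assume eq: "(\<lambda>b. b + z) ` B = (\<lambda>b. b + z') ` B"
  have "0 + z \<in> (\<lambda>b. b + z) ` B"
    using assms unfolding add_subgroup_def by blast
  then show "z - z' \<in> B" unfolding eq by auto
next
  have sub: "(\<lambda>b. b + x) ` B \<subseteq> (\<lambda>b. b + y) ` B" if "x - y \<in> B" for x y
  proof
    fix w assume "w \<in> (\<lambda>b. b + x) ` B"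
    then obtain b where "b \<in> B" "w = b + x" by auto
    then have "w = (b + (x - y)) + y" "b + (x - y) \<in> B"
      using add_subgroup_add[OF assms] that by auto
    then show "w \<in> (\<lambda>b. b + y) ` B" by blast
  qed
  assume "z - z' \<in> B"
  moreover from this have "z' - z \<in> B"
  proof -
    have "0 - (z - z') \<in> B"
      using assms \<open>z - z' \<in> B\<close> unfolding add_subgroup_def by blast
    then show ?thesis by simp
  qed
  ultimately show "(\<lambda>b. b + z) ` B = (\<lambda>b. b + z') ` B"
    using sub by blast
qed

text \<open>Representatives correspond bijectively to cosets, and since \<open>card\<close> is 0 on
  infinite sets, the equation also covers an infinite index.\<close>

lemma card_cosets_transversal:
  assumes "add_subgroup B" "R \<subseteq> Z"
    and "\<And>z. z \<in> Z \<Longrightarrow> \<exists>r\<in>R. z - r \<in> B"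
    and "\<And>r r'. r \<in> R \<Longrightarrow> r' \<in> R \<Longrightarrow> r - r' \<in> B \<Longrightarrow> r = r'"
  shows "card (cosets Z B) = card R"
proof -
  have "cosets Z B = (\<lambda>z. (\<lambda>b. b + z) ` B) ` R"
    unfolding cosets_def
  proof (rule antisym[OF subsetI image_mono[OF assms(2)]])
    fix K assume "K \<in> (\<lambda>z. (\<lambda>b. b + z) ` B) ` Z"
    then obtain z where z: "z \<in> Z" "K = (\<lambda>b. b + z) ` B" by blast
    then obtain r where "r \<in> R" "z - r \<in> B" using assms(3) by blast
    then show "K \<in> (\<lambda>z. (\<lambda>b. b + z) ` B) ` R"
      using z coset_eq_iff[OF assms(1)] by blast
  qed
  moreover have "inj_on (\<lambda>z. (\<lambda>b. b + z) ` B) R"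
    using assms(4) by (auto intro!: inj_onI simp: coset_eq_iff[OF assms(1)])
  ultimately show ?thesis by (simp add: card_image)
qed

lemma transversal_exists:
  assumes "add_subgroup B"
  shows "\<exists>R. R \<subseteq> Z \<and> (\<forall>z\<in>Z. \<exists>r\<in>R. z - r \<in> B) \<and> (\<forall>r\<in>R. \<forall>r'\<in>R. r - r' \<in> B \<longrightarrow> r = r')"
proof -
  define rep where "rep K = (SOME z. z \<in> Z \<and> (\<lambda>b. b + z) ` B = K)" for K
  have rep: "rep K \<in> Z \<and> (\<lambda>b. b + rep K) ` B = K" if "K \<in> cosets Z B" for K
  proof -
    from that have "\<exists>z. z \<in> Z \<and> (\<lambda>b. b + z) ` B = K" by (auto simp: cosets_def)
    then show "rep K \<in> Z \<and> (\<lambda>b. b + rep K) ` B = K" unfolding rep_def by (rule someI_ex)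
  qed
  show ?thesis
  proof (intro exI[of _ "rep ` cosets Z B"] conjI ballI impI)
    show "rep ` cosets Z B \<subseteq> Z" using rep by blast
    show "\<exists>r\<in>rep ` cosets Z B. z - r \<in> B" if "z \<in> Z" for z
    proof -
      have K: "(\<lambda>b. b + z) ` B \<in> cosets Z B" (is "?K \<in> _") using that by (auto simp: cosets_def)
      then have "z - rep ?K \<in> B"
        using rep[OF K] coset_eq_iff[OF assms, of z "rep ?K"] by simp
      then show ?thesis using K by blast
    qed
    show "r = r'" if rr: "r \<in> rep ` cosets Z B" "r' \<in> rep ` cosets Z B" "r - r' \<in> B" for r r'
    proof -
      have "(\<lambda>b. b + r) ` B = (\<lambda>b. b + r') ` B" using coset_eq_iff[OF assms] that(3) by blast
      moreover obtain K K' where K: "K \<in> cosets Z B" "r = rep K" "K' \<in> cosets Z B" "r' = rep K'"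
        using rr(1,2) by blast
      ultimately have "K = K'" using rep[OF K(1)] rep[OF K(3)] by simp
      then show ?thesis using K by simp
    qed
  qed
qed

lemma card_cosets_image:
  fixes \<phi> :: "'g::ab_group_add \<Rightarrow> 'h::ab_group_add"
  assumes "\<And>x y. \<phi> (x + y) = \<phi> x + \<phi> y" "inj_on \<phi> Z" "add_subgroup Z" "B \<subseteq> Z"
  shows "card (cosets (\<phi> ` Z) (\<phi> ` B)) = card (cosets Z B)"
proof -
  have "(\<lambda>b. b + \<phi> z) ` \<phi> ` B = \<phi> ` (\<lambda>b. b + z) ` B" for z
    by (auto simp: image_image assms(1))
  then have "cosets (\<phi> ` Z) (\<phi> ` B) = (`) \<phi> ` cosets Z B"
    by (simp add: cosets_def image_image)
  moreover have "inj_on ((`) \<phi>) (cosets Z B)"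
  proof (rule inj_on_subset[OF inj_on_image_Pow[OF assms(2)]])
    show "cosets Z B \<subseteq> Pow Z"
      using add_subgroup_add[OF assms(3)] assms(4) by (auto simp: cosets_def)
  qed
  ultimately show ?thesis by (simp add: card_image)
qed

section \<open>Lattices spanned by integer vectors\<close>

definition row_span :: "'b set \<Rightarrow> ('b \<Rightarrow> 'a \<Rightarrow>\<^sub>0 int) \<Rightarrow> ('a \<Rightarrow>\<^sub>0 int) set" where
  "row_span S V = range (\<lambda>a. \<Sum>l\<in>S. frag_cmul (a l) (V l))"

lemma add_subgroup_row_span: "add_subgroup (row_span S V)"
  unfolding add_subgroup_def row_span_def
proof safe
  show "0 \<in> range (\<lambda>a. \<Sum>l\<in>S. frag_cmul (a l) (V l))"
    by (rule range_eqI[of _ _ "\<lambda>_. 0"]) simp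
next
  fix a b :: "'b \<Rightarrow> int"
  show "(\<Sum>l\<in>S. frag_cmul (a l) (V l)) - (\<Sum>l\<in>S. frag_cmul (b l) (V l)) \<in>
      range (\<lambda>a. \<Sum>l\<in>S. frag_cmul (a l) (V l))"
    by (rule range_eqI[of _ _ "\<lambda>l. a l - b l"])
      (simp add: frag_cmul_diff_distrib sum_subtractf)
qed

lemma row_span_shear_subset:
  assumes "finite S" "p \<in> S" "q \<in> S"
  shows "row_span S (V(p := V p + frag_cmul c (V q))) \<subseteq> row_span S V"
proof
  fix x assume "x \<in> row_span S (V(p := V p + frag_cmul c (V q)))"
  then obtain a where x: "x = (\<Sum>l\<in>S. frag_cmul (a l) ((V(p := V p + frag_cmul c (V q))) l))"
    by (auto simp: row_span_def)
  have "x = (\<Sum>l\<in>S. frag_cmul (a l) (V l) + (if l = p then frag_cmul (a p * c) (V q) else 0))"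
    unfolding x by (intro sum.cong refl) (auto simp: frag_cmul_distrib2)
  also have "\<dots> = (\<Sum>l\<in>S. frag_cmul (a l) (V l)) + frag_cmul (a p * c) (V q)"
    using assms by (simp add: sum.distrib)
  also have "\<dots> = (\<Sum>l\<in>S. frag_cmul (a l) (V l) + (if l = q then frag_cmul (a p * c) (V q) else 0))"
    using assms by (simp add: sum.distrib)
  also have "\<dots> = (\<Sum>l\<in>S. frag_cmul ((a(q := a q + a p * c)) l) (V l))"
    by (intro sum.cong refl) (auto simp: frag_cmul_distrib)
  finally show "x \<in> row_span S V" by (auto simp: row_span_def)
qed

lemma row_span_shear:
  assumes "finite S" "p \<in> S" "q \<in> S" "p \<noteq> q"
  shows "row_span S (V(p := V p + frag_cmul c (V q))) = row_span S V" (is "row_span S ?W = _")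
proof (rule antisym)
  show "row_span S ?W \<subseteq> row_span S V"
    by (rule row_span_shear_subset) fact+
  \<comment> \<open>The shear is undone by the shear with \<open>- c\<close>, so the inclusion for
    arbitrary rows also gives the converse one.\<close>
  have "?W(p := ?W p + frag_cmul (- c) (?W q)) = V"
    using assms(4)
    by (auto simp: fun_eq_iff minus_frag_cmul[symmetric] simp del: minus_frag_cmul)
  then show "row_span S V \<subseteq> row_span S ?W"
    using row_span_shear_subset[OF assms(1-3), of ?W "- c"] by simp
qed

text \<open>Euclid's algorithm on column \<open>s\<close>, phrased as the minimisation of the column's 1-norm
  over all systems of rows obtainable by elementary operations.\<close>

lemma exists_cleared_column:
  fixes V :: "'a \<Rightarrow> 'a \<Rightarrow>\<^sub>0 int"
  assumes S: "finite S" "s \<in> S" and V: "\<And>l. l \<in> S \<Longrightarrow> Poly_Mapping.keys (V l) \<subseteq> S"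
  shows "\<exists>W. row_span S W = row_span S V \<and>
    det_on S (\<lambda>l. Poly_Mapping.lookup (W l)) = det_on S (\<lambda>l. Poly_Mapping.lookup (V l)) \<and>
    (\<forall>l\<in>S. Poly_Mapping.keys (W l) \<subseteq> S) \<and> (\<forall>l\<in>S - {s}. Poly_Mapping.lookup (W l) s = 0)"
proof -
  define P where "P W \<longleftrightarrow> row_span S W = row_span S V \<and>
    det_on S (\<lambda>l. Poly_Mapping.lookup (W l)) = det_on S (\<lambda>l. Poly_Mapping.lookup (V l)) \<and>
    (\<forall>l\<in>S. Poly_Mapping.keys (W l) \<subseteq> S)" for W :: "'a \<Rightarrow> 'a \<Rightarrow>\<^sub>0 int"
  define N where "N W = (\<Sum>l\<in>S. nat \<bar>Poly_Mapping.lookup (W l) s\<bar>)" for W :: "'a \<Rightarrow> 'a \<Rightarrow>\<^sub>0 int"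
  have shear: "P (W(p := W p + frag_cmul c (W q)))" (is "P ?W")
    if W: "P W" and pq: "p \<in> S" "q \<in> S" "p \<noteq> q" for W p q c
  proof -
    have "(\<lambda>l. Poly_Mapping.lookup (?W l)) =
        (\<lambda>l. Poly_Mapping.lookup (W l))(p := \<lambda>j. Poly_Mapping.lookup (W p) j + c * Poly_Mapping.lookup (W q) j)"
      by (auto simp: fun_eq_iff lookup_add)
    then have "det_on S (\<lambda>l. Poly_Mapping.lookup (?W l)) = det_on S (\<lambda>l. Poly_Mapping.lookup (W l))"
      using det_on_add_row[OF S(1) pq(1,2) pq(3)[symmetric], of "\<lambda>l. Poly_Mapping.lookup (W l)" c] by simp
    moreover have "Poly_Mapping.keys (?W l) \<subseteq> S" if "l \<in> S" for l
    proof (cases "l = p")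
      case True
      have "Poly_Mapping.keys (W p) \<subseteq> S" "Poly_Mapping.keys (frag_cmul c (W q)) \<subseteq> S"
        using W pq keys_cmul[of c "W q"] by (auto simp only: P_def)
      then show ?thesis using True keys_add[of "W p" "frag_cmul c (W q)"] by auto
    qed (use that W in \<open>simp add: P_def\<close>)
    ultimately show ?thesis
      using W row_span_shear[OF S(1) pq, of W c] unfolding P_def by simp
  qed
  have "P V" unfolding P_def using V by simp
  then obtain W where W: "P W" and least: "\<And>W'. P W' \<Longrightarrow> N W \<le> N W'"
    using ex_has_least_nat[of P V N] by metis
  \<comment> \<open>By minimality, no entry of the column is at least as large as another nonzero
    entry, for it could then be reduced. As this holds in both directions, two nonzero entries
    cannot coexist.\<close>
  have smaller: "Poly_Mapping.lookup (W q) s = 0 \<or> \<bar>Poly_Mapping.lookup (W p) s\<bar> < \<bar>Poly_Mapping.lookup (W q) s\<bar>"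
    if pq: "p \<in> S" "q \<in> S" "p \<noteq> q" for p q
  proof (rule ccontr)
    let ?x = "Poly_Mapping.lookup (W p) s" and ?y = "Poly_Mapping.lookup (W q) s"
    assume "\<not> (?y = 0 \<or> \<bar>?x\<bar> < \<bar>?y\<bar>)"
    then have xy: "?y \<noteq> 0" "\<bar>?y\<bar> \<le> \<bar>?x\<bar>" by auto
    \<comment> \<open>This sign makes \<open>c * ?y\<close> point against \<open>?x\<close>; as
      \<open>?y\<close> is nonzero and not larger than \<open>?x\<close> in absolute value, the sum
      becomes strictly smaller.\<close>
    define c where "c = - (sgn ?x * sgn ?y)"
    have dec: "\<bar>?x + c * ?y\<bar> < \<bar>?x\<bar>"
    proof (cases "(?x > 0) = (?y > 0)")
      case True
      then have "c = - 1" using xy by (auto simp: c_def sgn_if)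
      then show ?thesis using True xy by arith
    next
      case False
      then have "c = 1" using xy by (auto simp: c_def sgn_if)
      then show ?thesis using False xy by arith
    qed
    have "N (W(p := W p + frag_cmul c (W q))) < N W"
      unfolding N_def
    proof (rule sum_strict_mono_ex1[OF S(1)])
      show "\<forall>l\<in>S. nat \<bar>Poly_Mapping.lookup ((W(p := W p + frag_cmul c (W q))) l) s\<bar> \<le> nat \<bar>Poly_Mapping.lookup (W l) s\<bar>"
        using dec by (auto simp: lookup_add)
      show "\<exists>l\<in>S. nat \<bar>Poly_Mapping.lookup ((W(p := W p + frag_cmul c (W q))) l) s\<bar> < nat \<bar>Poly_Mapping.lookup (W l) s\<bar>"
        using dec pq(1) xy by (intro bexI[of _ p]) (auto simp: lookup_add)
    qed
    then show False using least[OF shear[OF W pq, of c]] by simp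
  qed
  have only_one: "Poly_Mapping.lookup (W p) s = 0 \<or> Poly_Mapping.lookup (W q) s = 0" if "p \<in> S" "q \<in> S" "p \<noteq> q" for p q
    using smaller[of p q] smaller[of q p] that by auto
  show ?thesis
  proof (cases "\<forall>l\<in>S - {s}. Poly_Mapping.lookup (W l) s = 0")
    case True
    then show ?thesis using W unfolding P_def by blast
  next
    case False
    then obtain p where p: "p \<in> S" "p \<noteq> s" "Poly_Mapping.lookup (W p) s \<noteq> 0" by auto
    \<comment> \<open>The surviving entry sits in row \<open>p\<close>. Two shears move it to row
      \<open>s\<close> and, unlike a swap, keep the determinant: rows \<open>s\<close> and
      \<open>p\<close> become \<open>W s + W p\<close> and \<open>- W s\<close>.\<close>
    define W1 where "W1 = W(s := W s + frag_cmul 1 (W p))"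
    define W2 where "W2 = W1(p := W1 p + frag_cmul (- 1) (W1 s))"
    have "P W2" unfolding W2_def W1_def
      using W p S(2) by (intro shear) auto
    moreover have "Poly_Mapping.lookup (W2 l) s = 0" if "l \<in> S - {s}" for l
    proof (cases "l = p")
      case True
      then show ?thesis
        using p only_one[of s p] S(2) by (simp add: W2_def W1_def lookup_add)
    next
      case False
      then show ?thesis
        using p only_one[of l p] that by (simp add: W2_def W1_def)
    qed
    ultimately show ?thesis unfolding P_def by blast
  qed
qed

text \<open>If the index is infinite, \<open>card\<close> returns 0, and the determinant vanishes as well.\<close>

theorem card_cosets_row_span:
  fixes V :: "'a \<Rightarrow> 'a \<Rightarrow>\<^sub>0 int"
  assumes "finite S" "\<And>l. l \<in> S \<Longrightarrow> Poly_Mapping.keys (V l) \<subseteq> S"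
  shows "int (card (cosets {c. Poly_Mapping.keys c \<subseteq> S} (row_span S V))) = \<bar>det_on S (\<lambda>l. Poly_Mapping.lookup (V l))\<bar>"
  using assms
proof (induction S arbitrary: V)
  case empty
  then show ?case by (simp add: cosets_def row_span_def)
next
  case (insert s S V')
  let ?S = "insert s S"
  have "finite ?S" using insert(1) by simp
  from exists_cleared_column[OF this insertI1 insert.prems]
  obtain V where *: "row_span ?S V = row_span ?S V' \<and>
    det_on ?S (\<lambda>l. Poly_Mapping.lookup (V l)) = det_on ?S (\<lambda>l. Poly_Mapping.lookup (V' l)) \<and>
    (\<forall>l\<in>?S. Poly_Mapping.keys (V l) \<subseteq> ?S) \<and> (\<forall>l\<in>?S - {s}. Poly_Mapping.lookup (V l) s = 0)"
    ..
  then have V: "row_span ?S V = row_span ?S V'"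
    "det_on ?S (\<lambda>l. Poly_Mapping.lookup (V l)) = det_on ?S (\<lambda>l. Poly_Mapping.lookup (V' l))"
    "\<And>l. l \<in> ?S \<Longrightarrow> Poly_Mapping.keys (V l) \<subseteq> ?S"
    "\<And>l. l \<in> ?S - {s} \<Longrightarrow> Poly_Mapping.lookup (V l) s = 0"
    by blast+
  have V0: "Poly_Mapping.lookup (V l) s = 0" if "l \<in> S" for l using V(4) that insert(2) by auto
  have VS: "Poly_Mapping.keys (V l) \<subseteq> S" if "l \<in> S" for l
    using V(3)[of l] V0[OF that] that by (auto simp: in_keys_iff)
  define d where "d = Poly_Mapping.lookup (V s) s"
  have det: "det_on ?S (\<lambda>l. Poly_Mapping.lookup (V' l)) = d * det_on S (\<lambda>l. Poly_Mapping.lookup (V l))"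
    unfolding V(2)[symmetric] d_def
    by (rule det_on_insert_column) (use insert(1,2) V0 in auto)
  have span_lookup: "Poly_Mapping.lookup (\<Sum>l\<in>S. frag_cmul (a l) (V l)) s = 0" for a
    using V0 by (simp add: lookup_sum)
  have span_insert: "x \<in> row_span ?S V \<longleftrightarrow> (\<exists>a. x - frag_cmul a (V s) \<in> row_span S V)" for x
  proof
    assume "x \<in> row_span ?S V"
    then obtain a where "x = (\<Sum>l\<in>?S. frag_cmul (a l) (V l))" by (auto simp: row_span_def)
    then have "x - frag_cmul (a s) (V s) = (\<Sum>l\<in>S. frag_cmul (a l) (V l))"
      using insert(1,2) by simp
    then show "\<exists>a. x - frag_cmul a (V s) \<in> row_span S V" by (auto simp: row_span_def)
  next
    assume "\<exists>a. x - frag_cmul a (V s) \<in> row_span S V"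
    then obtain a b where ab: "x - frag_cmul a (V s) = (\<Sum>l\<in>S. frag_cmul (b l) (V l))"
      by (auto simp: row_span_def)
    have "(\<Sum>l\<in>S. frag_cmul (b l) (V l)) = (\<Sum>l\<in>S. frag_cmul ((b(s := a)) l) (V l))"
      using insert(2) by (intro sum.cong refl) auto
    then have "x = (\<Sum>l\<in>?S. frag_cmul ((b(s := a)) l) (V l))"
      using ab insert(1,2) by (simp add: algebra_simps)
    then show "x \<in> row_span ?S V" by (auto simp: row_span_def)
  qed
  note sub = add_subgroup_row_span
  show ?case
  proof (cases "d = 0")
    case True
    \<comment> \<open>Every vector of the lattice now has coordinate 0 at \<open>s\<close>, so
      distinct multiples of the unit vector at \<open>s\<close> lie in distinct cosets and the index
      is infinite.\<close>
    have "inj (\<lambda>c. (\<lambda>b. b + frag_cmul c (frag_of s)) ` row_span ?S V)"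
    proof (rule injI)
      fix c c' assume "(\<lambda>b. b + frag_cmul c (frag_of s)) ` row_span ?S V =
        (\<lambda>b. b + frag_cmul c' (frag_of s)) ` row_span ?S V"
      then have "frag_cmul c (frag_of s) - frag_cmul c' (frag_of s) \<in> row_span ?S V"
        unfolding coset_eq_iff[OF sub] .
      then obtain a where
        "frag_cmul c (frag_of s) - frag_cmul c' (frag_of s) - frag_cmul a (V s) \<in> row_span S V"
        using span_insert by blast
      then have "Poly_Mapping.lookup
          (frag_cmul c (frag_of s) - frag_cmul c' (frag_of s) - frag_cmul a (V s)) s = 0"
        using span_lookup by (auto simp: row_span_def)
      then show "c = c'" using True by (simp add: lookup_minus d_def)
    qed
    then have "infinite (range (\<lambda>c. (\<lambda>b. b + frag_cmul c (frag_of s)) ` row_span ?S V))"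
      using infinite_UNIV_int finite_imageD by blast
    moreover have "range (\<lambda>c. (\<lambda>b. b + frag_cmul c (frag_of s)) ` row_span ?S V)
        \<subseteq> cosets {c. Poly_Mapping.keys c \<subseteq> ?S} (row_span ?S V)"
      by (auto simp: cosets_def)
    ultimately have "infinite (cosets {c. Poly_Mapping.keys c \<subseteq> ?S} (row_span ?S V))"
      using infinite_super by blast
    then show ?thesis using V(1) det True by simp
  next
    case False
    obtain R where R: "R \<subseteq> {c. Poly_Mapping.keys c \<subseteq> S}"
      "\<And>z. z \<in> {c. Poly_Mapping.keys c \<subseteq> S} \<Longrightarrow> \<exists>r\<in>R. z - r \<in> row_span S V"
      "\<And>r r'. r \<in> R \<Longrightarrow> r' \<in> R \<Longrightarrow> r - r' \<in> row_span S V \<Longrightarrow> r = r'"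
      using transversal_exists[OF sub, of "{c. Poly_Mapping.keys c \<subseteq> S}" S V] by blast
    have R0: "Poly_Mapping.lookup r s = 0" if "r \<in> R" for r
    proof -
      have "s \<notin> Poly_Mapping.keys r" using R(1) that insert(2) by blast
      then show ?thesis by (simp add: in_keys_iff)
    qed
    \<comment> \<open>A residue modulo \<open>d\<close> for the coordinate \<open>s\<close>,
      together with a representative \<open>r\<close> for the other coordinates, represents each
      coset once; the residues yield the factor by which the index grows.\<close>
    define g where "g = (\<lambda>(i, r). frag_cmul i (frag_of s) + r)"
    have g_diff: "i = i' \<and> r = r'" if ir: "i \<in> {0..<\<bar>d\<bar>}" "i' \<in> {0..<\<bar>d\<bar>}" "r \<in> R" "r' \<in> R"
      "g (i, r) - g (i', r') \<in> row_span ?S V" for i i' r r'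
    proof -
      obtain a where a: "g (i, r) - g (i', r') - frag_cmul a (V s) \<in> row_span S V"
        using ir(5) span_insert by blast
      then have "Poly_Mapping.lookup (g (i, r) - g (i', r') - frag_cmul a (V s)) s = 0"
        using span_lookup by (auto simp: row_span_def)
      then have "i - i' = a * d"
        using R0 ir(3,4) by (simp add: g_def lookup_add lookup_minus d_def)
      moreover have "\<bar>i - i'\<bar> < \<bar>d\<bar>" using ir(1,2) by auto
      ultimately have "\<bar>a\<bar> * \<bar>d\<bar> < 1 * \<bar>d\<bar>" by (simp add: abs_mult)
      then have "\<bar>a\<bar> < 1" using False by (auto simp only: mult_less_cancel_right)
      then have "a = 0" by simp
      with \<open>i - i' = a * d\<close> have "i = i'" by simp
      moreover have "r - r' \<in> row_span S V"
        using a \<open>a = 0\<close> \<open>i = i'\<close> by (simp add: g_def)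
      ultimately show ?thesis using R(3) ir(3,4) by blast
    qed
    have "card (cosets {c. Poly_Mapping.keys c \<subseteq> ?S} (row_span ?S V)) = card (g ` ({0..<\<bar>d\<bar>} \<times> R))"
    proof (rule card_cosets_transversal[OF sub])
      show "g ` ({0..<\<bar>d\<bar>} \<times> R) \<subseteq> {c. Poly_Mapping.keys c \<subseteq> ?S}"
      proof
        fix y assume "y \<in> g ` ({0..<\<bar>d\<bar>} \<times> R)"
        then obtain i r where y: "y = frag_cmul i (frag_of s) + r" "r \<in> R" by (auto simp: g_def)
        have "Poly_Mapping.keys y \<subseteq> insert s (Poly_Mapping.keys r)"
          unfolding y using keys_add[of "frag_cmul i (frag_of s)" r] by auto
        then show "y \<in> {c. Poly_Mapping.keys c \<subseteq> ?S}" using R(1) y(2) by blast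
      qed
      show "\<exists>r\<in>g ` ({0..<\<bar>d\<bar>} \<times> R). z - r \<in> row_span ?S V" if "z \<in> {c. Poly_Mapping.keys c \<subseteq> ?S}" for z
      proof -
        define i where "i = Poly_Mapping.lookup z s mod \<bar>d\<bar>"
        \<comment> \<open>Division with remainder is by the absolute value of \<open>d\<close>; the
          factor \<open>sgn d\<close> converts the quotient into a coefficient of \<open>d\<close>
          itself.\<close>
        define a where "a = sgn d * (Poly_Mapping.lookup z s div \<bar>d\<bar>)"
        have "i + a * d = Poly_Mapping.lookup z s"
        proof -
          have "a * d = \<bar>d\<bar> * (Poly_Mapping.lookup z s div \<bar>d\<bar>)"
            unfolding a_def by (cases "d > 0") (use False in \<open>simp_all add: sgn_if\<close>)
          then show ?thesis
            unfolding i_def by (simp only: mod_mult_div_eq)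
        qed
        define y where "y = z - frag_cmul i (frag_of s) - frag_cmul a (V s)"
        have "Poly_Mapping.lookup y s = 0"
          using \<open>i + a * d = Poly_Mapping.lookup z s\<close> by (simp add: y_def lookup_minus d_def)
        moreover have "Poly_Mapping.keys y \<subseteq> ?S"
          unfolding y_def using that V(3)[of s]
          by (intro order_trans[OF keys_diff] Un_least) (auto split: if_splits)
        ultimately have "Poly_Mapping.keys y \<subseteq> S" by (auto simp: in_keys_iff)
        then obtain r where r: "r \<in> R" "y - r \<in> row_span S V" using R(2) by blast
        have "z - g (i, r) - frag_cmul a (V s) = y - r" by (simp add: y_def g_def algebra_simps)
        then have "z - g (i, r) \<in> row_span ?S V" using r(2) span_insert by metis
        moreover have "i \<in> {0..<\<bar>d\<bar>}" using False by (simp add: i_def)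
        ultimately show ?thesis using r(1) by blast
      qed
      show "x = x'" if xx: "x \<in> g ` ({0..<\<bar>d\<bar>} \<times> R)" "x' \<in> g ` ({0..<\<bar>d\<bar>} \<times> R)"
        "x - x' \<in> row_span ?S V" for x x'
      proof -
        obtain i r i' r' where "x = g (i, r)" "x' = g (i', r')"
          "i \<in> {0..<\<bar>d\<bar>}" "r \<in> R" "i' \<in> {0..<\<bar>d\<bar>}" "r' \<in> R"
          using xx(1,2) by blast
        then show ?thesis using g_diff[of i i' r r'] xx(3) by simp
      qed
    qed
    also have "\<dots> = card ({0..<\<bar>d\<bar>} \<times> R)"
    proof (rule card_image, rule inj_onI)
      fix x x' assume x: "x \<in> {0..<\<bar>d\<bar>} \<times> R" "x' \<in> {0..<\<bar>d\<bar>} \<times> R" "g x = g x'"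
      then have "g x - g x' \<in> row_span ?S V"
        using sub[of ?S V] unfolding add_subgroup_def by simp
      moreover obtain i r i' r' where ir: "x = (i, r)" "x' = (i', r')" by (cases x, cases x')
      ultimately show "x = x'" using g_diff[of i i' r r'] x by simp
    qed
    also have "\<dots> = nat \<bar>d\<bar> * card (cosets {c. Poly_Mapping.keys c \<subseteq> S} (row_span S V))"
      using card_cosets_transversal[OF sub R] by (simp add: card_cartesian_product)
    finally show ?thesis
      using insert.IH[of V] VS V(1) det by (simp add: abs_mult)
  qed
qed

section \<open>Boundary coefficients and the Laplacian\<close>

text \<open>Indexed by cardinality: the \<open>k\<close>-faces are \<open>ksets m (Suc k)\<close>,
  and \<open>ksets m 0\<close> contains just the empty face.\<close>

definition ksets :: "nat \<Rightarrow> nat \<Rightarrow> nat set set" where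
  "ksets m k = {\<tau>. \<tau> \<subseteq> {1..m} \<and> card \<tau> = k}"

lemma finite_ksets [simp]: "finite (ksets m k)"
  by (rule finite_subset[of _ "Pow {1..m}"]) (auto simp: ksets_def)

lemma finite_mem_ksets: "\<tau> \<in> ksets m k \<Longrightarrow> finite \<tau>"
  unfolding ksets_def using finite_subset by blast

lemma card_ksets: "card (ksets m k) = m choose k"
  unfolding ksets_def using n_subsets[of "{1..m}" k] by simp

lemma insert_mem_ksets:
  assumes "\<tau> \<in> ksets m k" "v \<in> {1..m} - \<tau>"
  shows "insert v \<tau> \<in> ksets m (Suc k)"
  using assms finite_mem_ksets[OF assms(1)] by (auto simp: ksets_def)

lemma remove_mem_ksets:
  assumes "\<tau> \<in> ksets m (Suc k)" "v \<in> \<tau>"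
  shows "\<tau> - {v} \<in> ksets m k"
  using assms finite_mem_ksets[OF assms(1)] by (auto simp: ksets_def)

lemma ksets_Suc_avoid: "{\<tau> \<in> ksets (Suc m) k. Suc m \<notin> \<tau>} = ksets m k"
proof -
  have "\<tau> \<subseteq> {1..m}" if "\<tau> \<subseteq> {1..Suc m}" "Suc m \<notin> \<tau>" for \<tau>
  proof
    fix x assume "x \<in> \<tau>"
    with that have "x \<in> {1..Suc m}" "x \<noteq> Suc m" by auto
    then show "x \<in> {1..m}" by auto
  qed
  then show ?thesis by (auto simp: ksets_def)
qed

lemma not_mem_ksets: "\<tau> \<in> ksets m k \<Longrightarrow> Suc m \<notin> \<tau>"
  by (auto simp: ksets_def)

lemma ksets_mono: "ksets m k \<subseteq> ksets (Suc m) k"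
  by (auto simp: ksets_def)

lemma bij_betw_insert_ksets:
  "bij_betw (insert (Suc m)) (ksets m k) {\<tau> \<in> ksets (Suc m) (Suc k). Suc m \<in> \<tau>}"
proof (rule bij_betw_byWitness[where f' = "\<lambda>\<tau>. \<tau> - {Suc m}"])
  show "\<forall>\<tau>\<in>ksets m k. insert (Suc m) \<tau> - {Suc m} = \<tau>" using not_mem_ksets by auto
  show "\<forall>\<tau>\<in>{\<tau> \<in> ksets (Suc m) (Suc k). Suc m \<in> \<tau>}. insert (Suc m) (\<tau> - {Suc m}) = \<tau>" by auto
  show "insert (Suc m) ` ksets m k \<subseteq> {\<tau> \<in> ksets (Suc m) (Suc k). Suc m \<in> \<tau>}"
  proof (rule image_subsetI)
    fix \<tau> assume \<tau>: "\<tau> \<in> ksets m k"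
    then have "\<tau> \<in> ksets (Suc m) k" using ksets_mono by blast
    then have "insert (Suc m) \<tau> \<in> ksets (Suc m) (Suc k)"
      by (rule insert_mem_ksets) (use not_mem_ksets[OF \<tau>] in simp)
    then show "insert (Suc m) \<tau> \<in> {\<tau> \<in> ksets (Suc m) (Suc k). Suc m \<in> \<tau>}" by simp
  qed
  show "(\<lambda>\<tau>. \<tau> - {Suc m}) ` {\<tau> \<in> ksets (Suc m) (Suc k). Suc m \<in> \<tau>} \<subseteq> ksets m k"
    unfolding ksets_Suc_avoid[of m k, symmetric] using remove_mem_ksets by auto
qed

text \<open>The vertex \<open>v\<close> need not belong to \<open>\<tau>\<close>. Because
  \<open>u < v\<close> is strict, \<open>\<tau>\<close> and \<open>insert v \<tau>\<close> give the
  same sign, so one formula serves both removing and adding a vertex.\<close>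

definition pos_sign :: "nat set \<Rightarrow> nat \<Rightarrow> int" where
  "pos_sign \<tau> v = (- 1) ^ card {u \<in> \<tau>. u < v}"

lemma pos_sign_square [simp]: "pos_sign \<tau> v * pos_sign \<tau> v = 1"
  by (simp add: pos_sign_def flip: power_add mult_2)

lemma pos_sign_nonzero [simp]: "pos_sign \<tau> v \<noteq> 0"
  by (simp add: pos_sign_def)

lemma pos_sign_insert_self [simp]: "pos_sign (insert v \<tau>) v = pos_sign \<tau> v"
  unfolding pos_sign_def by (rule arg_cong[of _ _ "\<lambda>A. (- 1) ^ card A"]) auto

lemma pos_sign_insert:
  assumes "finite \<tau>" "a \<notin> \<tau>"
  shows "pos_sign (insert a \<tau>) b = (if a < b then - pos_sign \<tau> b else pos_sign \<tau> b)"
proof (cases "a < b")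
  case True
  then have "{u \<in> insert a \<tau>. u < b} = insert a {u \<in> \<tau>. u < b}" by auto
  then show ?thesis using assms True by (simp add: pos_sign_def)
next
  case False
  then have "{u \<in> insert a \<tau>. u < b} = {u \<in> \<tau>. u < b}" by auto
  then show ?thesis using False by (simp add: pos_sign_def)
qed

text \<open>Entry of the boundary matrix in row \<open>\<rho>\<close> and column
  \<open>\<tau>\<close>, for all dimensions at once.\<close>

definition bdc :: "nat set \<Rightarrow> nat set \<Rightarrow> int" where
  "bdc \<rho> \<tau> = Poly_Mapping.lookup (face_boundary (frag_of \<tau>)) \<rho>"

lemma bdc_eq_sum: "bdc \<rho> \<tau> = (\<Sum>v\<in>\<tau>. if \<rho> = \<tau> - {v} then pos_sign \<tau> v else 0)"
  unfolding bdc_def face_boundary_def frag_extend_of lookup_sum pos_sign_def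
  by (intro sum.cong) auto

lemma bdc_insert:
  assumes "finite \<rho>" "v \<notin> \<rho>"
  shows "bdc \<rho> (insert v \<rho>) = pos_sign \<rho> v"
proof -
  have eq: "\<rho> = insert v \<rho> - {w} \<longleftrightarrow> w = v" if "w \<in> insert v \<rho>" for w
    using assms(2) that by auto
  have "bdc \<rho> (insert v \<rho>) = (\<Sum>w\<in>insert v \<rho>. if w = v then pos_sign (insert v \<rho>) v else 0)"
    unfolding bdc_eq_sum by (intro sum.cong refl) (simp add: eq)
  then show ?thesis using assms(1) by simp
qed

lemma bdc_nonzeroE:
  assumes "bdc \<rho> \<tau> \<noteq> 0"
  obtains v where "v \<notin> \<rho>" "\<tau> = insert v \<rho>"
proof -
  have "\<exists>v\<in>\<tau>. \<rho> = \<tau> - {v}"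
  proof (rule ccontr)
    assume "\<not> (\<exists>v\<in>\<tau>. \<rho> = \<tau> - {v})"
    then have "bdc \<rho> \<tau> = 0" unfolding bdc_eq_sum by (intro sum.neutral) auto
    then show False using assms by simp
  qed
  then obtain v where "v \<in> \<tau>" "\<rho> = \<tau> - {v}" by blast
  then show ?thesis by (intro that[of v]) auto
qed

text \<open>Among the rows that avoid \<open>v\<close>, the column of a cone with apex
  \<open>v\<close> meets only the base of the cone, with coefficient 1 or -1. The minors that
  witness positivity below are diagonal for this reason.\<close>

lemma bdc_insert_new:
  assumes "finite \<rho>" "v \<notin> \<rho>" "v \<notin> \<tau>"
  shows "bdc \<rho> (insert v \<tau>) = (if \<rho> = \<tau> then pos_sign \<rho> v else 0)"
proof (cases "bdc \<rho> (insert v \<tau>) = 0")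
  case True
  then show ?thesis using bdc_insert[OF assms(1,2)] by auto
next
  case False
  then obtain w where "w \<notin> \<rho>" "insert v \<tau> = insert w \<rho>" by (rule bdc_nonzeroE)
  moreover from this have "v = w" using assms(2) by blast
  ultimately have "\<rho> = \<tau>" using assms(2,3) by (simp add: insert_ident)
  then show ?thesis using bdc_insert[OF assms(1,2)] by simp
qed

lemma sum_bdc_cofaces:
  assumes "\<tau> \<in> ksets m k"
  shows "(\<Sum>\<sigma>\<in>ksets m (Suc k). bdc \<tau> \<sigma> * f \<sigma>) = (\<Sum>v\<in>{1..m} - \<tau>. pos_sign \<tau> v * f (insert v \<tau>))"
proof -
  have inj: "inj_on (\<lambda>v. insert v \<tau>) ({1..m} - \<tau>)" by (auto simp: inj_on_def)
  have "(\<Sum>\<sigma>\<in>ksets m (Suc k). bdc \<tau> \<sigma> * f \<sigma>) =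
      (\<Sum>\<sigma>\<in>(\<lambda>v. insert v \<tau>) ` ({1..m} - \<tau>). bdc \<tau> \<sigma> * f \<sigma>)"
  proof (rule sum.mono_neutral_right)
    show "(\<lambda>v. insert v \<tau>) ` ({1..m} - \<tau>) \<subseteq> ksets m (Suc k)"
      using insert_mem_ksets[OF assms] by blast
    show "\<forall>\<sigma>\<in>ksets m (Suc k) - (\<lambda>v. insert v \<tau>) ` ({1..m} - \<tau>). bdc \<tau> \<sigma> * f \<sigma> = 0"
    proof
      fix \<sigma> assume \<sigma>: "\<sigma> \<in> ksets m (Suc k) - (\<lambda>v. insert v \<tau>) ` ({1..m} - \<tau>)"
      have "bdc \<tau> \<sigma> = 0"
      proof (rule ccontr)
        assume "bdc \<tau> \<sigma> \<noteq> 0"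
        then obtain v where v: "v \<notin> \<tau>" "\<sigma> = insert v \<tau>" by (rule bdc_nonzeroE)
        then have "v \<in> {1..m} - \<tau>" using \<sigma> by (auto simp: ksets_def)
        then show False using \<sigma> v by blast
      qed
      then show "bdc \<tau> \<sigma> * f \<sigma> = 0" by simp
    qed
  qed simp
  also have "\<dots> = (\<Sum>v\<in>{1..m} - \<tau>. pos_sign \<tau> v * f (insert v \<tau>))"
    unfolding sum.reindex[OF inj] o_def
    by (intro sum.cong refl) (simp add: bdc_insert[OF finite_mem_ksets[OF assms]])
  finally show ?thesis .
qed

lemma sum_bdc_faces:
  assumes "\<tau> \<in> ksets m (Suc k)"
  shows "(\<Sum>\<rho>\<in>ksets m k. bdc \<rho> \<tau> * f \<rho>) = (\<Sum>v\<in>\<tau>. pos_sign \<tau> v * f (\<tau> - {v}))"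
proof -
  have inj: "inj_on (\<lambda>v. \<tau> - {v}) \<tau>" by (auto simp: inj_on_def)
  have "(\<Sum>\<rho>\<in>ksets m k. bdc \<rho> \<tau> * f \<rho>) = (\<Sum>\<rho>\<in>(\<lambda>v. \<tau> - {v}) ` \<tau>. bdc \<rho> \<tau> * f \<rho>)"
  proof (rule sum.mono_neutral_right)
    show "(\<lambda>v. \<tau> - {v}) ` \<tau> \<subseteq> ksets m k"
      using remove_mem_ksets[OF assms] by blast
    show "\<forall>\<rho>\<in>ksets m k - (\<lambda>v. \<tau> - {v}) ` \<tau>. bdc \<rho> \<tau> * f \<rho> = 0"
    proof
      fix \<rho> assume \<rho>: "\<rho> \<in> ksets m k - (\<lambda>v. \<tau> - {v}) ` \<tau>"
      have "bdc \<rho> \<tau> = 0"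
      proof (rule ccontr)
        assume "bdc \<rho> \<tau> \<noteq> 0"
        then obtain v where "v \<notin> \<rho>" "\<tau> = insert v \<rho>" by (rule bdc_nonzeroE)
        then have "v \<in> \<tau>" "\<rho> = \<tau> - {v}" by auto
        then show False using \<rho> by blast
      qed
      then show "bdc \<rho> \<tau> * f \<rho> = 0" by simp
    qed
  qed simp
  also have "\<dots> = (\<Sum>v\<in>\<tau>. pos_sign \<tau> v * f (\<tau> - {v}))"
    unfolding sum.reindex[OF inj] o_def
  proof (intro sum.cong refl)
    fix v assume "v \<in> \<tau>"
    then have "insert v (\<tau> - {v}) = \<tau>" by auto
    then show "bdc (\<tau> - {v}) \<tau> * f (\<tau> - {v}) = pos_sign \<tau> v * f (\<tau> - {v})"
      using bdc_insert[of "\<tau> - {v}" v] pos_sign_insert_self[of v "\<tau> - {v}"]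
        finite_mem_ksets[OF assms] by simp
  qed
  finally show ?thesis .
qed

text \<open>If some term is nonzero, then \<open>\<sigma>\<close> is \<open>\<rho>\<close> with two
  vertices added. Only the two orders of removing them contribute, and they cancel because the
  presence of the smaller vertex flips the sign of the larger one.\<close>

lemma bdc_bdc:
  assumes "\<sigma> \<in> ksets m (Suc k)"
  shows "(\<Sum>\<tau>\<in>ksets m k. bdc \<rho> \<tau> * bdc \<tau> \<sigma>) = 0"
proof -
  have sum: "(\<Sum>\<tau>\<in>ksets m k. bdc \<rho> \<tau> * bdc \<tau> \<sigma>) = (\<Sum>v\<in>\<sigma>. pos_sign \<sigma> v * bdc \<rho> (\<sigma> - {v}))"
    using sum_bdc_faces[OF assms, of "bdc \<rho>"] by (simp add: mult.commute)
  show ?thesis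
  proof (cases "\<forall>v\<in>\<sigma>. bdc \<rho> (\<sigma> - {v}) = 0")
    case True
    then show ?thesis unfolding sum by simp
  next
    case False
    then obtain b where b: "b \<in> \<sigma>" "bdc \<rho> (\<sigma> - {b}) \<noteq> 0" by blast
    from b(2) obtain a where a: "a \<notin> \<rho>" "\<sigma> - {b} = insert a \<rho>" by (rule bdc_nonzeroE)
    have \<sigma>: "\<sigma> = insert a (insert b \<rho>)" and ab: "a \<noteq> b" "b \<notin> \<rho>" using a b(1) by auto
    have fin: "finite \<rho>" using finite_mem_ksets[OF assms] \<sigma> by simp
    have zero: "bdc \<rho> (\<sigma> - {v}) = 0" if "v \<in> \<sigma> - {a, b}" for v
    proof (rule ccontr)
      assume "bdc \<rho> (\<sigma> - {v}) \<noteq> 0"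
      then obtain w where "w \<notin> \<rho>" "\<sigma> - {v} = insert w \<rho>" by (rule bdc_nonzeroE)
      then show False using that \<sigma> by auto
    qed
    have "(\<Sum>v\<in>\<sigma>. pos_sign \<sigma> v * bdc \<rho> (\<sigma> - {v})) = (\<Sum>v\<in>{a, b}. pos_sign \<sigma> v * bdc \<rho> (\<sigma> - {v}))"
      using zero \<sigma> fin by (intro sum.mono_neutral_right) auto
    also have "\<dots> = pos_sign \<sigma> a * bdc \<rho> (\<sigma> - {a}) + pos_sign \<sigma> b * bdc \<rho> (\<sigma> - {b})"
      using ab by simp
    also have "\<sigma> - {a} = insert b \<rho>" using \<sigma> ab a by auto
    also have "\<sigma> - {b} = insert a \<rho>" by (rule a)
    also have "pos_sign \<sigma> a = pos_sign (insert b \<rho>) a" unfolding \<sigma> by simp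
    also have "pos_sign \<sigma> b = pos_sign (insert a \<rho>) b"
      unfolding \<sigma> insert_commute[of a b] by simp
    finally show ?thesis
      unfolding sum using ab a(1) fin
      by (auto simp: bdc_insert pos_sign_insert neq_iff)
  qed
qed

text \<open>The identity \<open>D D\<^sup>T + D'\<^sup>T D' = m I\<close> for the full simplex. On
  the diagonal every vertex counts once, as one to add or as one to remove. Off the diagonal only
  \<open>insert a \<rho>\<close> and \<open>insert b \<rho>\<close> interact, through their union
  and through \<open>\<rho>\<close>, with opposite signs.\<close>

lemma laplacian:
  assumes \<tau>: "\<tau> \<in> ksets m (Suc k)" and \<tau>': "\<tau>' \<in> ksets m (Suc k)"
  shows "(\<Sum>\<sigma>\<in>ksets m (Suc (Suc k)). bdc \<tau> \<sigma> * bdc \<tau>' \<sigma>) + (\<Sum>\<rho>\<in>ksets m k. bdc \<rho> \<tau> * bdc \<rho> \<tau>') =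
    (if \<tau> = \<tau>' then int m else 0)"
proof -
  have fin: "finite \<tau>" "finite \<tau>'" using assms finite_mem_ksets by auto
  have up: "(\<Sum>\<sigma>\<in>ksets m (Suc (Suc k)). bdc \<tau> \<sigma> * bdc \<tau>' \<sigma>) =
      (\<Sum>v\<in>{1..m} - \<tau>. pos_sign \<tau> v * bdc \<tau>' (insert v \<tau>))"
    by (rule sum_bdc_cofaces[OF \<tau>])
  have down: "(\<Sum>\<rho>\<in>ksets m k. bdc \<rho> \<tau> * bdc \<rho> \<tau>') = (\<Sum>v\<in>\<tau>. pos_sign \<tau> v * bdc (\<tau> - {v}) \<tau>')"
    by (rule sum_bdc_faces[OF \<tau>])
  show ?thesis
  proof (cases "\<tau> = \<tau>'")
    case True
    have "(\<Sum>v\<in>{1..m} - \<tau>. pos_sign \<tau> v * bdc \<tau>' (insert v \<tau>)) = (\<Sum>v\<in>{1..m} - \<tau>. 1)"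
      unfolding True[symmetric] by (intro sum.cong refl) (simp add: bdc_insert fin)
    moreover have "(\<Sum>v\<in>\<tau>. pos_sign \<tau> v * bdc (\<tau> - {v}) \<tau>') = (\<Sum>v\<in>\<tau>. 1)"
      unfolding True[symmetric]
    proof (intro sum.cong refl)
      fix v assume "v \<in> \<tau>"
      then have "insert v (\<tau> - {v}) = \<tau>" by auto
      then show "pos_sign \<tau> v * bdc (\<tau> - {v}) \<tau> = 1"
        using bdc_insert[of "\<tau> - {v}" v] pos_sign_insert_self[of v "\<tau> - {v}"] fin by simp
    qed
    moreover have "card ({1..m} - \<tau>) = m - card \<tau>" "card \<tau> \<le> m"
      using \<tau> fin card_mono[of "{1..m}" \<tau>] by (auto simp: ksets_def card_Diff_subset)
    ultimately show ?thesis unfolding up down using True by simp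
  next
    case False
    show ?thesis
    proof (cases "\<exists>a b \<rho>. a \<notin> \<rho> \<and> b \<notin> \<rho> \<and> \<tau> = insert a \<rho> \<and> \<tau>' = insert b \<rho>")
      case True
      then obtain a b \<rho> where ab: "a \<notin> \<rho>" "b \<notin> \<rho>" "\<tau> = insert a \<rho>" "\<tau>' = insert b \<rho>" by blast
      then have neq: "a \<noteq> b" using False by auto
      have fin\<rho>: "finite \<rho>" using fin ab by simp
      have b: "b \<in> {1..m} - \<tau>" using \<tau>' ab neq by (auto simp: ksets_def)
      have zero_up: "bdc \<tau>' (insert v \<tau>) = 0" if "v \<in> {1..m} - \<tau> - {b}" for v
      proof (rule ccontr)
        assume "bdc \<tau>' (insert v \<tau>) \<noteq> 0"
        then obtain w where "insert v \<tau> = insert w \<tau>'" by (rule bdc_nonzeroE)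
        then have "b \<in> insert v \<tau>" using ab by auto
        then show False using that b by auto
      qed
      have zero_down: "bdc (\<tau> - {v}) \<tau>' = 0" if "v \<in> \<tau> - {a}" for v
      proof (rule ccontr)
        assume "bdc (\<tau> - {v}) \<tau>' \<noteq> 0"
        then obtain w where "\<tau>' = insert w (\<tau> - {v})" by (rule bdc_nonzeroE)
        then have "a \<in> \<tau>'" using ab that by auto
        then show False using ab neq by auto
      qed
      have "(\<Sum>v\<in>{1..m} - \<tau>. pos_sign \<tau> v * bdc \<tau>' (insert v \<tau>)) =
          (\<Sum>v\<in>{b}. pos_sign \<tau> v * bdc \<tau>' (insert v \<tau>))"
        using zero_up b by (intro sum.mono_neutral_right) auto
      moreover have "(\<Sum>v\<in>\<tau>. pos_sign \<tau> v * bdc (\<tau> - {v}) \<tau>') =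
          (\<Sum>v\<in>{a}. pos_sign \<tau> v * bdc (\<tau> - {v}) \<tau>')"
        using zero_down ab fin by (intro sum.mono_neutral_right) auto
      moreover have "insert b \<tau> = insert a \<tau>'" "\<tau> - {a} = \<rho>" using ab by auto
      moreover have "bdc \<tau>' (insert a \<tau>') = pos_sign \<tau>' a"
        using ab neq fin by (intro bdc_insert) auto
      moreover have "bdc \<rho> \<tau>' = pos_sign \<rho> b" unfolding ab using ab fin\<rho> by (intro bdc_insert) auto
      moreover have "pos_sign \<tau> b * pos_sign \<tau>' a + pos_sign \<tau> a * pos_sign \<rho> b = 0"
        unfolding ab(3,4) pos_sign_insert_self using fin\<rho> ab neq
        by (auto simp: pos_sign_insert neq_iff)
      ultimately show ?thesis unfolding up down using False by simp
    next
      case none: False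
      have zero_up: "bdc \<tau>' (insert v \<tau>) = 0" if "v \<in> {1..m} - \<tau>" for v
      proof (rule ccontr)
        assume "bdc \<tau>' (insert v \<tau>) \<noteq> 0"
        then obtain w where w: "w \<notin> \<tau>'" "insert v \<tau> = insert w \<tau>'" by (rule bdc_nonzeroE)
        have "v \<noteq> w"
        proof
          assume "v = w"
          then have "\<tau> = \<tau>'" using w that by (simp add: insert_ident)
          then show False using False by simp
        qed
        then have "\<tau> = insert w (\<tau> - {w})" "\<tau>' = insert v (\<tau> - {w})" using w that by auto
        moreover have "w \<notin> \<tau> - {w}" "v \<notin> \<tau> - {w}" using that by auto
        ultimately have "\<exists>a b \<rho>. a \<notin> \<rho> \<and> b \<notin> \<rho> \<and> \<tau> = insert a \<rho> \<and> \<tau>' = insert b \<rho>"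
          by (intro exI[of _ w] exI[of _ v] exI[of _ "\<tau> - {w}"] conjI)
        then show False using none by contradiction
      qed
      have zero_down: "bdc (\<tau> - {v}) \<tau>' = 0" if "v \<in> \<tau>" for v
      proof (rule ccontr)
        assume "bdc (\<tau> - {v}) \<tau>' \<noteq> 0"
        then obtain w where w: "w \<notin> \<tau> - {v}" "\<tau>' = insert w (\<tau> - {v})" by (rule bdc_nonzeroE)
        moreover have "v \<notin> \<tau> - {v}" "\<tau> = insert v (\<tau> - {v})" using that by auto
        ultimately have "\<exists>a b \<rho>. a \<notin> \<rho> \<and> b \<notin> \<rho> \<and> \<tau> = insert a \<rho> \<and> \<tau>' = insert b \<rho>"
          by (intro exI[of _ v] exI[of _ w] exI[of _ "\<tau> - {v}"] conjI)
        then show False using none by contradiction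
      qed
      show ?thesis unfolding up down using False zero_up zero_down by simp
    qed
  qed
qed

section \<open>Weighted hypertree sums\<close>

lemma det_on_scale_rows:
  "det_on S (\<lambda>i j. c i * A i j) = (\<Prod>i\<in>S. c i) * det_on S A"
  by (simp add: det_on_def prod.distrib sum_distrib_left mult_ac)

lemma det_on_scale_columns:
  assumes "finite S"
  shows "det_on S (\<lambda>i j. A i j * c j) = det_on S A * (\<Prod>i\<in>S. c i)"
proof -
  have "det_on S (\<lambda>i j. A i j * c j) = det_on S (\<lambda>i j. c i * A j i)"
    using det_on_transpose[OF assms, of "\<lambda>i j. A i j * c j"] by (simp add: mult.commute)
  also have "\<dots> = (\<Prod>i\<in>S. c i) * det_on S (\<lambda>i j. A j i)"
    by (rule det_on_scale_rows)
  finally show ?thesis using det_on_transpose[OF assms, of A] by simp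
qed

text \<open>The largest family of \<open>k\<close>-element faces whose link at
  \<open>\<sigma>\<close> stays inside \<open>L\<close>. A general \<open>\<sigma>\<close> lets
  cylinders be composed vertex by vertex.\<close>

definition cylinder :: "nat \<Rightarrow> nat \<Rightarrow> nat set \<Rightarrow> nat set set \<Rightarrow> nat set set" where
  "cylinder n k \<sigma> L = {\<tau> \<in> ksets n k. \<sigma> \<subseteq> \<tau> \<longrightarrow> \<tau> - \<sigma> \<in> L}"

text \<open>By the Cauchy-Binet formula this is the sum of the squared torsions of all
  \<open>k\<close>-dimensional hypertrees on \<open>{1..m}\<close> whose \<open>k\<close>-faces lie in \<open>K\<close>.\<close>

definition tree_sum :: "nat \<Rightarrow> nat \<Rightarrow> nat set set \<Rightarrow> int" where
  "tree_sum m k K = gram_det (ksets (m - 1) k) bdc K"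

text \<open>The cones with the last vertex as apex give a diagonal minor with entries 1 and -1, so
  the total weight can serve as a denominator.\<close>

lemma tree_sum_pos:
  assumes "m \<ge> 1"
  shows "tree_sum m k (ksets m (Suc k)) > 0"
proof -
  obtain m' where m: "m = Suc m'" using assms by (cases m) auto
  have "det_on (ksets m' k) (\<lambda>i j. bdc j (insert (Suc m') i)) =
      (\<Prod>i\<in>ksets m' k. bdc i (insert (Suc m') i))"
    by (rule det_on_diagonal)
      (use not_mem_ksets finite_mem_ksets in \<open>auto simp: bdc_insert_new\<close>)
  also have "\<dots> \<noteq> 0"
    using not_mem_ksets finite_mem_ksets by (auto simp: bdc_insert)
  finally show ?thesis
    unfolding tree_sum_def m diff_Suc_1
    using bij_betw_insert_ksets[of m' k]
    by (intro gram_det_pos[where f = "insert (Suc m')"]) (auto simp: bij_betw_def)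
qed

text \<open>With respect to the splitting of the \<open>k\<close>-subsets of \<open>{1..m}\<close> according to whether they contain
  \<open>m\<close>, the matrix \<open>U\<close> below stacks a basis of the row space of the boundary matrix \<open>D'\<close> below
  dimension \<open>k\<close> on top of a basis of the column space of the boundary matrix \<open>D\<close> above it. These
  spaces are orthogonal complements, and on the latter \<open>D D\<^sup>T\<close> acts as multiplication by \<open>m\<close>.\<close>

theorem tree_sum_cylinder:
  fixes m k :: nat and L :: "nat set set"
  defines "S \<equiv> ksets m (Suc k)"
  assumes m: "m \<ge> 1" and L: "L \<subseteq> S"
  shows "int (Suc m) ^ card (ksets (m - 1) k) * tree_sum m k S *
      tree_sum (Suc m) (Suc k) (cylinder (Suc m) (Suc (Suc k)) {Suc m} L) =
    int (Suc m) ^ card L * int m ^ card (S - L) * tree_sum m k L"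
proof -
  obtain m' where m': "m = Suc m'" using m by (cases m) auto
  define S1 where "S1 = {\<tau> \<in> S. m \<in> \<tau>}"
  define S0 where "S0 = {\<tau> \<in> S. m \<notin> \<tau>}"
  have finS: "finite S" "finite S1" "finite S0" "finite L"
    using finite_subset[OF L] by (simp_all add: S_def S1_def S0_def)
  have S10: "S = S1 \<union> S0" "S1 \<inter> S0 = {}" by (auto simp: S1_def S0_def)
  have bij: "bij_betw (insert m) (ksets m' k) S1"
    unfolding S1_def S_def m' by (rule bij_betw_insert_ksets)
  define C where "C = cylinder (Suc m) (Suc (Suc k)) {Suc m} L"
  define M where "M \<tau> \<tau>' = (\<Sum>\<sigma>\<in>C. bdc \<tau> \<sigma> * bdc \<tau>' \<sigma>)" for \<tau> \<tau>'
  \<comment> \<open>To make the matrix square on \<open>S\<close>, a face \<open>\<tau>\<close>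
    containing \<open>m\<close> names the row \<open>\<tau> - {m}\<close> of \<open>D'\<close>, and
    a face avoiding \<open>m\<close> names the column \<open>insert m \<tau>\<close> of
    \<open>D\<close>.\<close>
  define U where "U \<tau> \<tau>' = (if m \<in> \<tau> then bdc (\<tau> - {m}) \<tau>' else bdc \<tau>' (insert m \<tau>))" for \<tau> \<tau>'
  \<comment> \<open>This is \<open>U\<close> with the rows from \<open>D'\<close> cut down to the
    columns in \<open>L'\<close>; the rows that come from \<open>D\<close> stay whole.\<close>
  define W where "W L' \<tau> \<tau>' = (if m \<in> \<tau> then if \<tau>' \<in> L' then bdc (\<tau> - {m}) \<tau>' else 0
      else bdc \<tau>' (insert m \<tau>))" for L' \<tau> \<tau>'
  \<comment> \<open>Common column factors: \<open>m\<close> from \<open>D D\<^sup>T\<close>, plus 1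
    from the indicator of \<open>L\<close>. Rows from \<open>D'\<close> see only the indicator, so
    \<open>E\<close> scales them by the value that \<open>lam\<close> has on
    \<open>L\<close>.\<close>
  define lam where "lam \<tau> = int m + (if \<tau> \<in> L then 1 else 0)" for \<tau>
  define E where "E \<tau> = (if m \<in> \<tau> then int (Suc m) else 1)" for \<tau> :: "nat set"
  define Q where "Q = det_on S0 (\<lambda>i j. \<Sum>\<tau>\<in>S. bdc \<tau> (insert m i) * bdc \<tau> (insert m j))"

  have C: "C = ksets m (Suc (Suc k)) \<union> insert (Suc m) ` L"
    "ksets m (Suc (Suc k)) \<inter> insert (Suc m) ` L = {}"
  proof -
    have "insert (Suc m) ` L = {\<tau> \<in> ksets (Suc m) (Suc (Suc k)). Suc m \<in> \<tau> \<and> \<tau> - {Suc m} \<in> L}"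
    proof (intro equalityI subsetI)
      fix \<tau> assume "\<tau> \<in> insert (Suc m) ` L"
      then obtain l where l: "l \<in> L" "\<tau> = insert (Suc m) l" by blast
      then have "l \<in> ksets m (Suc k)" using L S_def by blast
      then have "\<tau> \<in> ksets (Suc m) (Suc (Suc k))" "Suc m \<notin> l"
        using bij_betw_insert_ksets[of m "Suc k"] l not_mem_ksets by (auto simp: bij_betw_def)
      then show "\<tau> \<in> {\<tau> \<in> ksets (Suc m) (Suc (Suc k)). Suc m \<in> \<tau> \<and> \<tau> - {Suc m} \<in> L}"
        using l by simp
    next
      fix \<tau> assume \<tau>: "\<tau> \<in> {\<tau> \<in> ksets (Suc m) (Suc (Suc k)). Suc m \<in> \<tau> \<and> \<tau> - {Suc m} \<in> L}"
      then have "\<tau> = insert (Suc m) (\<tau> - {Suc m})" by auto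
      then show "\<tau> \<in> insert (Suc m) ` L" using \<tau> by blast
    qed
    moreover have "C = {\<tau> \<in> ksets (Suc m) (Suc (Suc k)). Suc m \<notin> \<tau>} \<union>
        {\<tau> \<in> ksets (Suc m) (Suc (Suc k)). Suc m \<in> \<tau> \<and> \<tau> - {Suc m} \<in> L}"
      unfolding C_def cylinder_def by auto
    ultimately show "C = ksets m (Suc (Suc k)) \<union> insert (Suc m) ` L"
      using ksets_Suc_avoid by simp
    show "ksets m (Suc (Suc k)) \<inter> insert (Suc m) ` L = {}"
      using not_mem_ksets by blast
  qed
  have avoid: "Suc m \<notin> \<tau>" "finite \<tau>" if "\<tau> \<in> S" for \<tau>
    using that not_mem_ksets finite_mem_ksets by (auto simp: S_def)
  have M_eq: "M \<tau> \<tau>' = (\<Sum>\<sigma>\<in>ksets m (Suc (Suc k)). bdc \<tau> \<sigma> * bdc \<tau>' \<sigma>) +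
      (if \<tau> = \<tau>' \<and> \<tau>' \<in> L then 1 else 0)" if "\<tau> \<in> S" "\<tau>' \<in> S" for \<tau> \<tau>'
  proof -
    have inj: "inj_on (insert (Suc m)) L"
      by (rule inj_on_subset[OF bij_betw_imp_inj_on[OF bij_betw_insert_ksets] L[unfolded S_def]])
    have "(\<Sum>\<sigma>\<in>insert (Suc m) ` L. bdc \<tau> \<sigma> * bdc \<tau>' \<sigma>) =
        (\<Sum>l\<in>L. if l = \<tau> then if \<tau> = \<tau>' then 1 else 0 else 0)"
      unfolding sum.reindex[OF inj] o_def
    proof (intro sum.cong refl)
      fix l assume "l \<in> L"
      then have "l \<in> S" using L by blast
      then show "bdc \<tau> (insert (Suc m) l) * bdc \<tau>' (insert (Suc m) l) =
          (if l = \<tau> then if \<tau> = \<tau>' then 1 else 0 else 0)"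
        using avoid that by (simp add: bdc_insert_new)
    qed
    also have "\<dots> = (if \<tau> = \<tau>' \<and> \<tau>' \<in> L then 1 else 0)"
      using finS(4) by simp
    finally show ?thesis
      unfolding M_def C(1) using C(2) finS(4) by (simp add: sum.union_disjoint)
  qed
  have UM: "E \<tau> * (\<Sum>\<tau>'\<in>S. U \<tau> \<tau>' * M \<tau>' \<tau>'') = W L \<tau> \<tau>'' * lam \<tau>''"
    if \<tau>: "\<tau> \<in> S" and \<tau>'': "\<tau>'' \<in> S" for \<tau> \<tau>''
  proof (cases "m \<in> \<tau>")
    case True
    let ?\<rho> = "\<tau> - {m}"
    have "(\<Sum>\<tau>'\<in>S. U \<tau> \<tau>' * M \<tau>' \<tau>'') =
        (\<Sum>\<tau>'\<in>S. (\<Sum>\<sigma>\<in>ksets m (Suc (Suc k)). bdc ?\<rho> \<tau>' * bdc \<tau>' \<sigma> * bdc \<tau>'' \<sigma>) +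
          (if \<tau>' = \<tau>'' then if \<tau>'' \<in> L then bdc ?\<rho> \<tau>' else 0 else 0))"
      using \<tau>'' True by (intro sum.cong refl)
        (simp add: M_eq U_def distrib_left sum_distrib_left mult.assoc)
    also have "\<dots> = (\<Sum>\<tau>'\<in>S. \<Sum>\<sigma>\<in>ksets m (Suc (Suc k)). bdc ?\<rho> \<tau>' * bdc \<tau>' \<sigma> * bdc \<tau>'' \<sigma>) +
        (if \<tau>'' \<in> L then bdc ?\<rho> \<tau>'' else 0)"
      using finS(1) \<tau>'' by (simp add: sum.distrib)
    also have "(\<Sum>\<tau>'\<in>S. \<Sum>\<sigma>\<in>ksets m (Suc (Suc k)). bdc ?\<rho> \<tau>' * bdc \<tau>' \<sigma> * bdc \<tau>'' \<sigma>) =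
        (\<Sum>\<sigma>\<in>ksets m (Suc (Suc k)). (\<Sum>\<tau>'\<in>S. bdc ?\<rho> \<tau>' * bdc \<tau>' \<sigma>) * bdc \<tau>'' \<sigma>)"
      unfolding sum_distrib_right by (rule sum.swap)
    also have "\<dots> = 0"
      unfolding S_def by (intro sum.neutral ballI) (simp add: bdc_bdc)
    finally show ?thesis using True by (simp add: E_def W_def lam_def)
  next
    case False
    let ?\<sigma> = "insert m \<tau>"
    have \<sigma>: "?\<sigma> \<in> ksets m (Suc (Suc k))"
      using \<tau> False m unfolding S_def by (intro insert_mem_ksets) auto
    have "(\<Sum>\<tau>'\<in>S. U \<tau> \<tau>' * M \<tau>' \<tau>'') =
        (\<Sum>\<tau>'\<in>S. (if \<tau>' = \<tau>'' then bdc \<tau>'' ?\<sigma> * lam \<tau>'' else 0) -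
          (\<Sum>\<rho>\<in>ksets m k. bdc \<rho> \<tau>' * bdc \<tau>' ?\<sigma> * bdc \<rho> \<tau>''))"
    proof (intro sum.cong refl)
      fix \<tau>' assume \<tau>': "\<tau>' \<in> S"
      \<comment> \<open>The Laplacian replaces \<open>D D\<^sup>T\<close> by \<open>m\<close> times
        the identity minus \<open>D'\<^sup>T D'\<close>, and the latter annihilates the columns of
        \<open>D\<close>.\<close>
      have "M \<tau>' \<tau>'' = (if \<tau>' = \<tau>'' then lam \<tau>'' else 0) - (\<Sum>\<rho>\<in>ksets m k. bdc \<rho> \<tau>' * bdc \<rho> \<tau>'')"
        using laplacian[OF \<tau>'[unfolded S_def] \<tau>''[unfolded S_def]] M_eq[OF \<tau>' \<tau>'']
        by (cases "\<tau>' = \<tau>''") (simp_all add: lam_def algebra_simps)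
      then show "U \<tau> \<tau>' * M \<tau>' \<tau>'' = (if \<tau>' = \<tau>'' then bdc \<tau>'' ?\<sigma> * lam \<tau>'' else 0) -
          (\<Sum>\<rho>\<in>ksets m k. bdc \<rho> \<tau>' * bdc \<tau>' ?\<sigma> * bdc \<rho> \<tau>'')"
        using False by (simp add: U_def right_diff_distrib sum_distrib_left mult_ac)
    qed
    also have "\<dots> = bdc \<tau>'' ?\<sigma> * lam \<tau>'' - (\<Sum>\<tau>'\<in>S. \<Sum>\<rho>\<in>ksets m k. bdc \<rho> \<tau>' * bdc \<tau>' ?\<sigma> * bdc \<rho> \<tau>'')"
      using finS(1) \<tau>'' by (simp add: sum_subtractf)
    also have "(\<Sum>\<tau>'\<in>S. \<Sum>\<rho>\<in>ksets m k. bdc \<rho> \<tau>' * bdc \<tau>' ?\<sigma> * bdc \<rho> \<tau>'') =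
        (\<Sum>\<rho>\<in>ksets m k. (\<Sum>\<tau>'\<in>S. bdc \<rho> \<tau>' * bdc \<tau>' ?\<sigma>) * bdc \<rho> \<tau>'')"
      unfolding sum_distrib_right by (rule sum.swap)
    also have "\<dots> = 0"
      unfolding S_def by (intro sum.neutral ballI) (simp add: bdc_bdc[OF \<sigma>])
    finally show ?thesis using False by (simp add: E_def W_def)
  qed
  have detM: "det_on S M = tree_sum (Suc m) (Suc k) C"
    by (simp add: tree_sum_def gram_det_def M_def[abs_def] S_def)
  have prodE: "(\<Prod>\<tau>\<in>S. E \<tau>) = int (Suc m) ^ card (ksets m' k)"
  proof -
    have "(\<Prod>\<tau>\<in>S. E \<tau>) = (\<Prod>\<tau>\<in>S1. E \<tau>) * (\<Prod>\<tau>\<in>S0. E \<tau>)"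
      unfolding S10(1) by (rule prod.union_disjoint) (use finS S10 in auto)
    then show ?thesis using bij_betw_same_card[OF bij] by (simp add: E_def S1_def S0_def)
  qed
  have prod_lam: "(\<Prod>\<tau>\<in>S. lam \<tau>) = int (Suc m) ^ card L * int m ^ card (S - L)"
  proof -
    have "(\<Prod>\<tau>\<in>S. lam \<tau>) = (\<Prod>\<tau>\<in>S - L. lam \<tau>) * (\<Prod>\<tau>\<in>L. lam \<tau>)"
      by (rule prod.subset_diff) (use L finS in auto)
    then show ?thesis by (simp add: lam_def add.commute)
  qed
  have det1: "int (Suc m) ^ card (ksets m' k) * det_on S U * tree_sum (Suc m) (Suc k) C =
      det_on S (W L) * (int (Suc m) ^ card L * int m ^ card (S - L))"
  proof -
    have "det_on S (\<lambda>i j. E i * (\<Sum>l\<in>S. U i l * M l j)) = det_on S (\<lambda>i j. W L i j * lam j)"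
      by (rule det_on_cong) (rule UM)
    then show ?thesis
      unfolding det_on_scale_rows det_on_scale_columns[OF finS(1)] det_on_mult[OF finS(1)]
        detM prodE prod_lam by (simp only: mult.assoc)
  qed
  \<comment> \<open>The product of \<open>W L'\<close> with the transpose of \<open>U\<close> is
    block triangular, since the rows of \<open>D'\<close> are orthogonal to the columns of
    \<open>D\<close>. Its diagonal blocks have determinants \<open>tree_sum m k L'\<close> and
    \<open>Q\<close>.\<close>
  have det2: "det_on S (W L') * det_on S U = tree_sum m k L' * Q" if L': "L' \<subseteq> S" for L'
  proof -
    define A where "A i j = (\<Sum>l\<in>S. W L' i l * U j l)" for i j
    have "det_on S (W L') * det_on S U = det_on S (W L') * det_on S (\<lambda>l j. U j l)"
      using det_on_transpose[OF finS(1), of U] by simp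
    also have "\<dots> = det_on S A"
      unfolding A_def[abs_def] by (rule det_on_mult[OF finS(1), symmetric])
    also have "\<dots> = det_on S1 A * det_on S0 A"
      unfolding S10(1)
    proof (rule det_on_block[OF finS(2,3) S10(2)])
      fix i j assume ij: "i \<in> S0" "j \<in> S1"
      then have "insert m i \<in> ksets m (Suc (Suc k))"
        using m unfolding S0_def S_def by (intro insert_mem_ksets) auto
      then have "(\<Sum>l\<in>S. bdc (j - {m}) l * bdc l (insert m i)) = 0"
        unfolding S_def by (rule bdc_bdc)
      then show "A i j = 0" using ij by (simp add: A_def W_def U_def S1_def S0_def mult.commute)
    qed
    also have "det_on S0 A = Q"
      unfolding Q_def by (rule det_on_cong) (simp add: A_def W_def U_def S0_def)
    also have "det_on S1 A = tree_sum m k L'"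
    proof -
      have "det_on S1 A = det_on (ksets m' k) (\<lambda>i j. A (insert m i) (insert m j))"
        by (rule det_on_reindex[OF finite_ksets bij])
      also have "\<dots> = det_on (ksets m' k) (\<lambda>i j. \<Sum>l\<in>L'. bdc i l * bdc j l)"
      proof (rule det_on_cong)
        fix i j assume "i \<in> ksets m' k" "j \<in> ksets m' k"
        then have "insert m i - {m} = i" "insert m j - {m} = j"
          using not_mem_ksets unfolding m' by auto
        then have "A (insert m i) (insert m j) = (\<Sum>l\<in>S. if l \<in> L' then bdc i l * bdc j l else 0)"
          unfolding A_def W_def U_def by (intro sum.cong) auto
        also have "\<dots> = (\<Sum>l\<in>S \<inter> L'. bdc i l * bdc j l)"
          using finS(1) by (simp add: sum.inter_restrict)
        finally show "A (insert m i) (insert m j) = (\<Sum>l\<in>L'. bdc i l * bdc j l)"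
          using L' by (simp add: Int_absorb1)
      qed
      finally show ?thesis by (simp add: tree_sum_def gram_det_def m')
    qed
    finally show ?thesis .
  qed
  have Q: "Q > 0"
  proof -
    have "det_on S0 (\<lambda>i j. bdc i (insert m j)) = (\<Prod>i\<in>S0. bdc i (insert m i))"
      by (rule det_on_diagonal[OF finS(3)])
        (use avoid(2) in \<open>auto simp: S0_def bdc_insert_new\<close>)
    also have "\<dots> \<noteq> 0"
      using avoid(2) finS(3) by (auto simp: S0_def bdc_insert)
    finally have "gram_det S0 (\<lambda>i l. bdc l (insert m i)) S > 0"
      by (intro gram_det_pos[where f = "\<lambda>i. i"]) (use finS in \<open>auto simp: S0_def\<close>)
    then show ?thesis by (simp add: gram_det_def Q_def)
  qed
  have "W S i j = U i j" if "j \<in> S" for i j using that by (simp add: W_def U_def)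
  then have "det_on S (W S) = det_on S U" by (intro det_on_cong)
  then have U2: "det_on S U * det_on S U = tree_sum m k S * Q" using det2[of S] by simp
  \<comment> \<open>Multiplied by \<open>det_on S U\<close>, the equation \<open>det1\<close>
    contains that determinant only in the two products evaluated by \<open>det2\<close>, for
    \<open>S\<close> and for \<open>L\<close>; the common factor \<open>Q\<close> then
    cancels.\<close>
  have "(int (Suc m) ^ card (ksets m' k) * tree_sum m k S * tree_sum (Suc m) (Suc k) C) * Q =
      (int (Suc m) ^ card (ksets m' k) * det_on S U * tree_sum (Suc m) (Suc k) C) * det_on S U"
    using U2 by (simp add: mult_ac)
  also have "\<dots> = (int (Suc m) ^ card L * int m ^ card (S - L)) * (det_on S (W L) * det_on S U)"
    unfolding det1 by (simp only: mult_ac)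
  also have "\<dots> = (int (Suc m) ^ card L * int m ^ card (S - L) * tree_sum m k L) * Q"
    unfolding det2[OF L] by (simp only: mult_ac)
  finally show ?thesis
    using Q unfolding C_def m' by simp
qed

section \<open>Homology and torsion\<close>

lemma int_card_eq_dim [simp]: "int a = int k - 1 + 1 \<longleftrightarrow> a = k" "int a = int k + 1 \<longleftrightarrow> a = Suc k"
  "int a = int k + 1 + 1 \<longleftrightarrow> a = Suc (Suc k)" "int a \<le> int k - 1 + 1 \<longleftrightarrow> a \<le> k"
  "int a \<le> int k + 1 \<longleftrightarrow> a \<le> Suc k"
  by auto

section \<open>Cycles, boundaries and homology groups\<close>

lemma lookup_face_boundary:
  assumes "finite A" "Poly_Mapping.keys c \<subseteq> A"
  shows "Poly_Mapping.lookup (face_boundary c) \<rho> = (\<Sum>\<tau>\<in>A. Poly_Mapping.lookup c \<tau> * bdc \<rho> \<tau>)"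
proof -
  have "Poly_Mapping.lookup (face_boundary c) \<rho> =
      (\<Sum>\<tau>\<in>Poly_Mapping.keys c. Poly_Mapping.lookup c \<tau> * bdc \<rho> \<tau>)"
    unfolding bdc_def face_boundary_def frag_extend_of by (simp add: frag_extend_def lookup_sum)
  also have "\<dots> = (\<Sum>\<tau>\<in>A. Poly_Mapping.lookup c \<tau> * bdc \<rho> \<tau>)"
    using assms by (intro sum.mono_neutral_left) (auto simp: in_keys_iff)
  finally show ?thesis .
qed

lemma keys_face_boundary:
  assumes "Poly_Mapping.keys c \<subseteq> ksets m (Suc k)"
  shows "Poly_Mapping.keys (face_boundary c) \<subseteq> ksets m k"
proof
  fix \<rho> assume "\<rho> \<in> Poly_Mapping.keys (face_boundary c)"
  then have "(\<Sum>\<tau>\<in>ksets m (Suc k). Poly_Mapping.lookup c \<tau> * bdc \<rho> \<tau>) \<noteq> 0"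
    using lookup_face_boundary[OF finite_ksets assms] by (simp add: in_keys_iff)
  then obtain \<tau> where \<tau>: "\<tau> \<in> ksets m (Suc k)" "Poly_Mapping.lookup c \<tau> * bdc \<rho> \<tau> \<noteq> 0"
    by (rule sum.not_neutral_contains_not_neutral)
  then have "bdc \<rho> \<tau> \<noteq> 0" by simp
  then obtain v where "v \<notin> \<rho>" "\<tau> = insert v \<rho>" by (rule bdc_nonzeroE)
  then have "\<rho> = \<tau> - {v}" "v \<in> \<tau>" by auto
  then show "\<rho> \<in> ksets m k" using remove_mem_ksets[OF \<tau>(1)] by simp
qed

lemma face_boundary_face_boundary:
  assumes "Poly_Mapping.keys c \<subseteq> ksets m (Suc k)"
  shows "face_boundary (face_boundary c) = 0"
proof (rule poly_mapping_eqI)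
  fix \<rho>
  have "Poly_Mapping.lookup (face_boundary (face_boundary c)) \<rho> =
      (\<Sum>\<tau>\<in>ksets m k. (\<Sum>\<sigma>\<in>ksets m (Suc k). Poly_Mapping.lookup c \<sigma> * bdc \<tau> \<sigma>) * bdc \<rho> \<tau>)"
    unfolding lookup_face_boundary[OF finite_ksets keys_face_boundary[OF assms]]
      lookup_face_boundary[OF finite_ksets assms] ..
  also have "\<dots> = (\<Sum>\<sigma>\<in>ksets m (Suc k). Poly_Mapping.lookup c \<sigma> * (\<Sum>\<tau>\<in>ksets m k. bdc \<rho> \<tau> * bdc \<tau> \<sigma>))"
    unfolding sum_distrib_right sum_distrib_left
    by (subst sum.swap) (simp add: mult_ac)
  also have "\<dots> = 0"
    by (intro sum.neutral ballI) (simp add: bdc_bdc)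
  finally show "Poly_Mapping.lookup (face_boundary (face_boundary c)) \<rho> = Poly_Mapping.lookup 0 \<rho>"
    by simp
qed

lemma reduced_cycles_eq:
  "reduced_cycles j X = {c. Poly_Mapping.keys c \<subseteq> faces j X \<and> face_boundary c = 0}"
  by (auto simp: reduced_cycles_def kernel_def face_chain_group_def)

lemma reduced_boundaries_eq:
  "reduced_boundaries j X = face_boundary ` {c. Poly_Mapping.keys c \<subseteq> faces (j + 1) X}"
  by (simp add: reduced_boundaries_def face_chain_group_def free_Abelian_group_def)

lemma add_subgroup_cycles: "add_subgroup (reduced_cycles j X)"
  unfolding add_subgroup_def reduced_cycles_eq
proof (intro conjI ballI)
  fix x y assume "x \<in> {c. Poly_Mapping.keys c \<subseteq> faces j X \<and> face_boundary c = 0}"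
    "y \<in> {c. Poly_Mapping.keys c \<subseteq> faces j X \<and> face_boundary c = 0}"
  then show "x - y \<in> {c. Poly_Mapping.keys c \<subseteq> faces j X \<and> face_boundary c = 0}"
    using keys_diff[of x y] by (auto simp: face_boundary_def frag_extend_diff)
qed (simp add: face_boundary_def)

lemma add_subgroup_boundaries: "add_subgroup (reduced_boundaries j X)"
  unfolding add_subgroup_def reduced_boundaries_eq
proof (intro conjI ballI)
  have "face_boundary 0 = 0" by (simp add: face_boundary_def)
  then show "0 \<in> face_boundary ` {c. Poly_Mapping.keys c \<subseteq> faces (j + 1) X}"
    by (intro image_eqI[of _ _ 0]) auto
  fix x y assume "x \<in> face_boundary ` {c. Poly_Mapping.keys c \<subseteq> faces (j + 1) X}"
    "y \<in> face_boundary ` {c. Poly_Mapping.keys c \<subseteq> faces (j + 1) X}"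
  then obtain a b where ab: "x = face_boundary a" "y = face_boundary b"
    "Poly_Mapping.keys a \<subseteq> faces (j + 1) X" "Poly_Mapping.keys b \<subseteq> faces (j + 1) X"
    by auto
  then have "x - y = face_boundary (a - b)" "Poly_Mapping.keys (a - b) \<subseteq> faces (j + 1) X"
    using keys_diff[of a b] by (auto simp: face_boundary_def frag_extend_diff)
  then show "x - y \<in> face_boundary ` {c. Poly_Mapping.keys c \<subseteq> faces (j + 1) X}"
    by (intro image_eqI[of _ _ "a - b"]) auto
qed

lemma subgroup_free_Abelian_groupI:
  assumes "add_subgroup B" "\<And>c. c \<in> B \<Longrightarrow> Poly_Mapping.keys c \<subseteq> F"
  shows "subgroup B (free_Abelian_group F)"
proof (rule group.subgroupI[OF group_free_Abelian_group])
  show "B \<subseteq> carrier (free_Abelian_group F)" using assms(2) by auto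
  show "B \<noteq> {}" using assms(1) by (auto simp: add_subgroup_def)
  fix x y assume xy: "x \<in> B" "y \<in> B"
  have "0 - x \<in> B" using assms(1) xy(1) unfolding add_subgroup_def by blast
  then show "inv\<^bsub>free_Abelian_group F\<^esub> x \<in> B" using assms(2) xy(1) by simp
  show "x \<otimes>\<^bsub>free_Abelian_group F\<^esub> y \<in> B"
    using add_subgroup_add[OF assms(1) xy] by simp
qed

lemma carrier_reduced_homology:
  "carrier (reduced_homology j X) = cosets (reduced_cycles j X) (reduced_boundaries j X)"
proof -
  have "subgroup (reduced_cycles j X) (face_chain_group j X)"
    unfolding face_chain_group_def
    by (rule subgroup_free_Abelian_groupI[OF add_subgroup_cycles]) (simp add: reduced_cycles_eq)
  then have "carrier (subgroup_generated (face_chain_group j X) (reduced_cycles j X)) = reduced_cycles j X"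
    by (rule subgroup.carrier_subgroup_generated_subgroup)
  then show ?thesis
    unfolding reduced_homology_def carrier_FactGroup cosets_def
    by (intro image_cong) (auto simp: r_coset_def face_chain_group_def)
qed

lemma comm_group_reduced_homology:
  assumes "reduced_boundaries j X \<subseteq> reduced_cycles j X"
  shows "comm_group (reduced_homology j X)"
proof -
  let ?G = "face_chain_group j X"
  have G: "group ?G" "comm_group ?G"
    by (simp_all add: face_chain_group_def abelian_free_Abelian_group)
  have Z: "subgroup (reduced_cycles j X) ?G"
    unfolding face_chain_group_def
    by (rule subgroup_free_Abelian_groupI[OF add_subgroup_cycles]) (simp add: reduced_cycles_eq)
  have B: "subgroup (reduced_boundaries j X) ?G"
    unfolding face_chain_group_def
    by (rule subgroup_free_Abelian_groupI[OF add_subgroup_boundaries])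
      (use assms in \<open>auto simp: reduced_cycles_eq\<close>)
  have "subgroup (reduced_boundaries j X) (subgroup_generated ?G (reduced_cycles j X))"
    by (rule group.subgroup_of_subgroup_generated[OF G(1) assms B])
  then show ?thesis
    unfolding reduced_homology_def
    by (rule comm_group.abelian_FactGroup[OF group.abelian_subgroup_generated[OF G]])
qed

text \<open>Raising to the power \<open>order G\<close> is trivial in a finite group, so the
  constant coefficient \<open>order G\<close> refutes independence of every nonempty set.\<close>

lemma abelian_rank_finite:
  assumes "comm_group G" "finite (carrier G)"
  shows "abelian_rank G = 0"
proof -
  interpret comm_group G by fact
  have empty: "S = {}" if S: "int_independent G S" for S
  proof -
    have "finprod G (\<lambda>s. s [^]\<^bsub>G\<^esub> int (order G)) S = \<one>\<^bsub>G\<^esub>"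
    proof (rule finprod_one_eqI)
      fix s assume "s \<in> S"
      then have "s \<in> carrier G" using S by (auto simp: int_independent_def)
      then show "s [^]\<^bsub>G\<^esub> int (order G) = \<one>\<^bsub>G\<^esub>"
        unfolding int_pow_int by (rule pow_order_eq_1)
    qed
    then have "\<forall>s\<in>S. int (order G) = 0"
      using S unfolding int_independent_def by (elim conjE allE[of _ "\<lambda>_. int (order G)"]) simp
    moreover have "order G \<noteq> 0" using assms(2) order_gt_0_iff_finite by simp
    ultimately show "S = {}" by auto
  qed
  have "card ` {S. int_independent G S} \<subseteq> {0}"
  proof (rule image_subsetI)
    fix S assume "S \<in> {S. int_independent G S}"
    then have "S = {}" by (intro empty) simp
    then show "card S \<in> {0}" by simp
  qed
  \<comment> \<open>Both alternatives give rank 0, because the supremum of the empty set of naturals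
    is 0.\<close>
  then have "card ` {S. int_independent G S} = {} \<or> card ` {S. int_independent G S} = {0}"
    by (rule subset_singletonD)
  then show ?thesis unfolding abelian_rank_def by (auto simp: Sup_nat_def)
qed

section \<open>Complexes and their top-dimensional faces\<close>

lemma finite_complexes [simp]: "finite (complexes m k)"
  by (rule finite_subset[of _ "Pow (Pow {1..m})"])
    (auto simp: complexes_def simplicial_complex_def)

lemma faces_Pow: "faces (int k) (Pow {1..m}) = ksets m (Suc k)"
  by (auto simp: faces_def ksets_def)

context
  fixes m k :: nat and X :: "nat set set"
  assumes X: "X \<in> complexes m k"
begin

lemma faces_top_subset: "faces (int k) X \<subseteq> ksets m (Suc k)"
  using X by (auto simp: complexes_def simplicial_complex_def faces_def ksets_def)

lemma faces_below: "faces (int k - 1) X = ksets m k"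
  using X by (auto simp: complexes_def simplicial_complex_def full_skeleton_def faces_def ksets_def)

lemma faces_above: "faces (int k + 1) X = {}"
proof -
  have "int (card \<sigma>) \<le> int k + 1" if "\<sigma> \<in> X" for \<sigma>
    using X that unfolding complexes_def full_skeleton_def by blast
  then show ?thesis unfolding faces_def by fastforce
qed

lemma complex_eq: "X = full_skeleton m (int k - 1) \<union> faces (int k) X"
proof -
  have "int (card \<sigma>) = int k + 1" if "\<sigma> \<in> X" "\<sigma> \<notin> full_skeleton m (int k - 1)" for \<sigma>
  proof -
    have "\<sigma> \<in> full_skeleton m (int k)" using X that(1) unfolding complexes_def by blast
    then show ?thesis using that(2) unfolding full_skeleton_def by auto
  qed
  moreover have "full_skeleton m (int k - 1) \<subseteq> X" using X unfolding complexes_def by blast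
  ultimately show ?thesis unfolding faces_def by blast
qed

end

text \<open>Every family of \<open>k\<close>-faces can be the top dimension, because the proper
  subsets of a set with \<open>k + 1\<close> elements lie in the skeleton.\<close>

lemma complexesI:
  assumes "T \<subseteq> ksets m (Suc k)"
  shows "full_skeleton m (int k - 1) \<union> T \<in> complexes m k" (is "?X \<in> _")
    and "faces (int k) (full_skeleton m (int k - 1) \<union> T) = T"
proof -
  have face: "\<sigma> \<subseteq> {1..m} \<and> card \<sigma> \<le> Suc k" if "\<sigma> \<in> ?X" for \<sigma>
    using that assms by (auto simp: full_skeleton_def ksets_def)
  have down: "\<tau> \<in> ?X" if "\<sigma> \<in> ?X" "\<tau> \<subseteq> \<sigma>" for \<sigma> \<tau>
  proof (cases "\<tau> = \<sigma>")
    case False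
    have \<sigma>: "\<sigma> \<subseteq> {1..m}" "card \<sigma> \<le> Suc k"
      using face that(1) by blast+
    then have "finite \<sigma>" using finite_subset by blast
    then have "card \<tau> < card \<sigma>" using False that(2) by (intro psubset_card_mono) auto
    then have "\<tau> \<in> full_skeleton m (int k - 1)"
      using \<sigma> that(2) by (auto simp: full_skeleton_def)
    then show ?thesis by simp
  qed (use that in simp)
  have "{} \<in> ?X" by (simp add: full_skeleton_def)
  then have "simplicial_complex m ?X"
    unfolding simplicial_complex_def using face down by blast
  moreover have "?X \<subseteq> full_skeleton m (int k)"
    using face by (auto simp only: full_skeleton_def int_card_eq_dim)
  ultimately show "?X \<in> complexes m k" unfolding complexes_def by blast
  show "faces (int k) ?X = T"
  proof -
    have "card \<sigma> = Suc k" if "\<sigma> \<in> T" for \<sigma>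
      using assms that unfolding ksets_def by blast
    moreover have "card \<sigma> \<noteq> Suc k" if "\<sigma> \<in> full_skeleton m (int k - 1)" for \<sigma>
      using that by (auto simp: full_skeleton_def)
    ultimately show ?thesis unfolding faces_def int_card_eq_dim by blast
  qed
qed

text \<open>A cycle of \<open>(k - 1)\<close>-faces of the full skeleton is determined by its values on the faces that
  avoid the last vertex, and these values are arbitrary: the boundary of the cone with that vertex
  as apex realises them. So \<open>H\<close> below dimension \<open>k\<close> is the quotient of the lattice of all such values by
  the lattice spanned by the rows of the reduced boundary matrix.\<close>

theorem order_homology_eq_det:
  assumes X: "X \<in> complexes (Suc m) k" and f: "bij_betw f (ksets m k) (faces (int k) X)"
  shows "int (order (reduced_homology (int k - 1) X)) =
    \<bar>det_on (ksets m k) (\<lambda>l i. bdc i (f l))\<bar>"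
proof -
  let ?S = "ksets m k"
  let ?L = "{c :: nat set \<Rightarrow>\<^sub>0 int. Poly_Mapping.keys c \<subseteq> ?S}"
  define Z where "Z = reduced_cycles (int k - 1) X"
  define B where "B = reduced_boundaries (int k - 1) X"
  \<comment> \<open>The projection that forgets the faces containing the last vertex.\<close>
  define \<phi> where "\<phi> = frag_extend (\<lambda>\<tau>. if \<tau> \<in> ?S then frag_of \<tau> else 0)"
  have lookup_\<phi>: "Poly_Mapping.lookup (\<phi> c) \<tau> = (if \<tau> \<in> ?S then Poly_Mapping.lookup c \<tau> else 0)" for c \<tau>
  proof -
    have "Poly_Mapping.lookup (\<phi> c) \<tau> =
        (\<Sum>\<tau>'\<in>Poly_Mapping.keys c. if \<tau>' = \<tau> then if \<tau> \<in> ?S then Poly_Mapping.lookup c \<tau> else 0 else 0)"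
      unfolding \<phi>_def frag_extend_def lookup_sum by (intro sum.cong) auto
    then show ?thesis by (simp add: in_keys_iff)
  qed
  have T: "faces (int k) X \<subseteq> ksets (Suc m) (Suc k)" by (rule faces_top_subset[OF X])
  have Z: "Z = {c. Poly_Mapping.keys c \<subseteq> ksets (Suc m) k \<and> face_boundary c = 0}"
    unfolding Z_def reduced_cycles_eq faces_below[OF X] ..
  have B: "B = face_boundary ` {c. Poly_Mapping.keys c \<subseteq> faces (int k) X}"
    unfolding B_def reduced_boundaries_eq by simp
  have BZ: "B \<subseteq> Z"
    unfolding B Z
    using T keys_face_boundary face_boundary_face_boundary by blast
  have \<phi>_add: "\<phi> (x + y) = \<phi> x + \<phi> y" for x y
    unfolding \<phi>_def by (rule frag_extend_add)
  have inj: "inj_on \<phi> Z"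
  proof (rule inj_onI)
    fix c c' assume cc: "c \<in> Z" "c' \<in> Z" "\<phi> c = \<phi> c'"
    define d where "d = c - c'"
    have "d \<in> Z"
      using cc add_subgroup_cycles unfolding d_def Z_def add_subgroup_def by blast
    then have keys: "Poly_Mapping.keys d \<subseteq> ksets (Suc m) k" and bd: "face_boundary d = 0"
      by (auto simp: Z)
    have base: "Poly_Mapping.lookup d \<tau> = 0" if "\<tau> \<in> ?S" for \<tau>
      using arg_cong[OF cc(3), of "\<lambda>x. Poly_Mapping.lookup x \<tau>"] that
      by (simp add: lookup_\<phi> d_def lookup_minus)
    have "Poly_Mapping.lookup d \<tau> = 0" for \<tau>
    proof (cases "\<tau> \<in> ksets (Suc m) k \<and> Suc m \<in> \<tau>")
      case True
      let ?\<rho> = "\<tau> - {Suc m}"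
      \<comment> \<open>Of the cofaces of \<open>?\<rho>\<close>, only \<open>\<tau>\<close>
        contains the last vertex, and \<open>d\<close> vanishes on the others. The boundary
        coefficient at \<open>?\<rho>\<close> thus isolates the value of \<open>d\<close> at
        \<open>\<tau>\<close>.\<close>
      have "Poly_Mapping.lookup d \<tau>' * bdc ?\<rho> \<tau>' = 0"
        if "\<tau>' \<in> ksets (Suc m) k - {\<tau>}" for \<tau>'
      proof (rule ccontr)
        assume nz: "Poly_Mapping.lookup d \<tau>' * bdc ?\<rho> \<tau>' \<noteq> 0"
        then have "Suc m \<in> \<tau>'" using base that ksets_Suc_avoid[of m k] by auto
        moreover from nz have "bdc ?\<rho> \<tau>' \<noteq> 0" by simp
        then obtain v where "v \<notin> ?\<rho>" "\<tau>' = insert v ?\<rho>" by (rule bdc_nonzeroE)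
        ultimately have "\<tau>' = \<tau>" using True by auto
        then show False using that by simp
      qed
      then have "(\<Sum>\<tau>'\<in>ksets (Suc m) k. Poly_Mapping.lookup d \<tau>' * bdc ?\<rho> \<tau>') =
          (\<Sum>\<tau>'\<in>{\<tau>}. Poly_Mapping.lookup d \<tau>' * bdc ?\<rho> \<tau>')"
        using True by (intro sum.mono_neutral_right) auto
      then have "Poly_Mapping.lookup d \<tau> * bdc ?\<rho> \<tau> = 0"
        using lookup_face_boundary[OF finite_ksets keys, of ?\<rho>] bd by simp
      moreover have "insert (Suc m) ?\<rho> = \<tau>" using True by auto
      then have "bdc ?\<rho> \<tau> \<noteq> 0"
        using bdc_insert[of ?\<rho> "Suc m"] finite_mem_ksets[of \<tau>] True by auto
      ultimately show ?thesis by simp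
    next
      case False
      show ?thesis
      proof (cases "\<tau> \<in> ?S")
        case not: False
        then have "\<tau> \<notin> ksets (Suc m) k" using False ksets_Suc_avoid[of m k] by blast
        then have "\<tau> \<notin> Poly_Mapping.keys d" using keys by blast
        then show ?thesis by (simp add: in_keys_iff)
      qed (rule base)
    qed
    then have "d = 0" by (intro poly_mapping_eqI) simp
    then show "c = c'" by (simp add: d_def)
  qed
  have "\<phi> ` Z = ?L"
  proof (intro equalityI subsetI)
    fix x assume "x \<in> \<phi> ` Z"
    then show "x \<in> ?L" by (auto simp: in_keys_iff lookup_\<phi> split: if_splits)
  next
    fix x assume "x \<in> ?L"
    then have x: "Poly_Mapping.keys x \<subseteq> ?S" by simp
    \<comment> \<open>The factor at each cone is the sign with which its base occurs in its
      boundary; the two signs multiply to 1, so the base is recovered exactly.\<close>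
    define y where "y = frag_extend (\<lambda>\<tau>. frag_cmul (bdc \<tau> (insert (Suc m) \<tau>)) (frag_of (insert (Suc m) \<tau>))) x"
    have "Poly_Mapping.keys y \<subseteq> insert (Suc m) ` ?S"
      unfolding y_def
      by (rule order_trans[OF keys_frag_extend]) (use x in \<open>auto split: if_splits\<close>)
    also have "\<dots> \<subseteq> ksets (Suc m) (Suc k)"
      using bij_betw_insert_ksets[of m k] by (auto simp: bij_betw_def)
    finally have y: "Poly_Mapping.keys y \<subseteq> ksets (Suc m) (Suc k)" .
    have "face_boundary y \<in> Z"
      unfolding Z using keys_face_boundary[OF y] face_boundary_face_boundary[OF y] by simp
    moreover have "\<phi> (face_boundary y) = x"
    proof (rule poly_mapping_eqI)
      fix \<tau>
      have fb: "face_boundary y = (\<Sum>\<tau>'\<in>Poly_Mapping.keys x. frag_cmul (Poly_Mapping.lookup x \<tau>' *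
          bdc \<tau>' (insert (Suc m) \<tau>')) (face_boundary (frag_of (insert (Suc m) \<tau>'))))"
        unfolding y_def face_boundary_def
        by (subst (2) frag_extend_def) (simp add: frag_extend_sum frag_extend_cmul o_def)
      show "Poly_Mapping.lookup (\<phi> (face_boundary y)) \<tau> = Poly_Mapping.lookup x \<tau>"
      proof (cases "\<tau> \<in> ?S")
        case True
        have "Poly_Mapping.lookup (face_boundary y) \<tau> = (\<Sum>\<tau>'\<in>Poly_Mapping.keys x.
            Poly_Mapping.lookup x \<tau>' * bdc \<tau>' (insert (Suc m) \<tau>') * bdc \<tau> (insert (Suc m) \<tau>'))"
          unfolding fb by (simp add: lookup_sum bdc_def)
        also have "\<dots> = (\<Sum>\<tau>'\<in>Poly_Mapping.keys x. if \<tau>' = \<tau> then Poly_Mapping.lookup x \<tau> else 0)"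
        proof (intro sum.cong refl)
          fix \<tau>' assume "\<tau>' \<in> Poly_Mapping.keys x"
          then have "\<tau>' \<in> ?S" using x by blast
          then have "Suc m \<notin> \<tau>'" "finite \<tau>'" "Suc m \<notin> \<tau>" "finite \<tau>"
            using True not_mem_ksets finite_mem_ksets by auto
          then show "Poly_Mapping.lookup x \<tau>' * bdc \<tau>' (insert (Suc m) \<tau>') * bdc \<tau> (insert (Suc m) \<tau>') =
              (if \<tau>' = \<tau> then Poly_Mapping.lookup x \<tau> else 0)"
            by (auto simp: bdc_insert_new mult.assoc)
        qed
        also have "\<dots> = Poly_Mapping.lookup x \<tau>" by (simp add: in_keys_iff)
        finally show ?thesis using True by (simp add: lookup_\<phi>)
      next
        case False
        then have "\<tau> \<notin> Poly_Mapping.keys x" using x by blast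
        then show ?thesis using False by (simp add: lookup_\<phi> in_keys_iff)
      qed
    qed
    ultimately show "x \<in> \<phi> ` Z" by blast
  qed
  moreover have "\<phi> ` B = row_span ?S (\<lambda>l. \<phi> (face_boundary (frag_of (f l))))"
  proof -
    have comb: "\<phi> (face_boundary (\<Sum>l\<in>?S. frag_cmul (a l) (frag_of (f l)))) =
        (\<Sum>l\<in>?S. frag_cmul (a l) (\<phi> (face_boundary (frag_of (f l)))))" for a :: "nat set \<Rightarrow> int"
      unfolding \<phi>_def face_boundary_def
      by (simp add: frag_extend_sum frag_extend_cmul o_def)
    have "{c :: nat set \<Rightarrow>\<^sub>0 int. Poly_Mapping.keys c \<subseteq> faces (int k) X} =
        range (\<lambda>a. \<Sum>l\<in>?S. frag_cmul (a l) (frag_of (f l)))"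
    proof (intro equalityI subsetI)
      fix c :: "nat set \<Rightarrow>\<^sub>0 int" assume "c \<in> {c. Poly_Mapping.keys c \<subseteq> faces (int k) X}"
      then have c: "Poly_Mapping.keys c \<subseteq> faces (int k) X" by simp
      have "c = (\<Sum>t\<in>Poly_Mapping.keys c. frag_cmul (Poly_Mapping.lookup c t) (frag_of t))"
        using frag_expansion[of c] by (simp add: frag_extend_def)
      also have "\<dots> = (\<Sum>t\<in>faces (int k) X. frag_cmul (Poly_Mapping.lookup c t) (frag_of t))"
        using c finite_subset[OF T] by (intro sum.mono_neutral_left) (auto simp: in_keys_iff)
      also have "\<dots> = (\<Sum>l\<in>?S. frag_cmul (Poly_Mapping.lookup c (f l)) (frag_of (f l)))"
        by (rule sum.reindex_bij_betw[OF f, symmetric])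
      finally show "c \<in> range (\<lambda>a. \<Sum>l\<in>?S. frag_cmul (a l) (frag_of (f l)))"
        by (rule range_eqI[of _ _ "\<lambda>l. Poly_Mapping.lookup c (f l)"])
    next
      fix c assume "c \<in> range (\<lambda>a. \<Sum>l\<in>?S. frag_cmul (a l) (frag_of (f l)))"
      then obtain a where c: "c = (\<Sum>l\<in>?S. frag_cmul (a l) (frag_of (f l)))" by blast
      have "Poly_Mapping.keys c \<subseteq> (\<Union>l\<in>?S. Poly_Mapping.keys (frag_cmul (a l) (frag_of (f l))))"
        unfolding c by (rule keys_sum)
      also have "\<dots> \<subseteq> faces (int k) X"
        using f by (auto simp: bij_betw_def split: if_splits)
      finally show "c \<in> {c. Poly_Mapping.keys c \<subseteq> faces (int k) X}" by simp
    qed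
    then show ?thesis unfolding B row_span_def by (simp add: image_image comb)
  qed
  ultimately have "card (cosets Z B) =
      card (cosets ?L (row_span ?S (\<lambda>l. \<phi> (face_boundary (frag_of (f l))))))"
    using card_cosets_image[OF \<phi>_add inj _ BZ] add_subgroup_cycles by (simp add: Z_def)
  also have "int \<dots> = \<bar>det_on ?S (\<lambda>l. Poly_Mapping.lookup (\<phi> (face_boundary (frag_of (f l)))))\<bar>"
    by (rule card_cosets_row_span) (auto simp: in_keys_iff lookup_\<phi> split: if_splits)
  also have "det_on ?S (\<lambda>l. Poly_Mapping.lookup (\<phi> (face_boundary (frag_of (f l))))) =
      det_on ?S (\<lambda>l i. bdc i (f l))"
    by (rule det_on_cong) (simp add: lookup_\<phi> bdc_def)
  finally show ?thesis
    by (simp add: order_def carrier_reduced_homology Z_def B_def)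
qed

text \<open>Squaring removes the absolute value and the dependence on the enumeration
  \<open>f\<close>. An infinite group has \<open>order\<close> 0, in agreement with a vanishing
  minor.\<close>

lemma order_homology_square:
  assumes "m \<ge> 1" and X: "X \<in> complexes m k" and card: "card (faces (int k) X) = (m - 1) choose k"
  shows "int (order (reduced_homology (int k - 1) X)) ^ 2 = tree_sum m k (faces (int k) X)"
proof -
  obtain m' where m: "m = Suc m'" using assms(1) by (cases m) auto
  have "finite (faces (int k) X)"
    using faces_top_subset[OF X] finite_ksets finite_subset by blast
  then obtain f where f: "bij_betw f (ksets m' k) (faces (int k) X)"
    using card finite_same_card_bij[of "ksets m' k" "faces (int k) X"] by (auto simp: card_ksets m)
  show ?thesis
    unfolding order_homology_eq_det[OF X[unfolded m] f] tree_sum_def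
    using gram_det_bij[OF finite_ksets f, of bdc] by (simp add: m)
qed

text \<open>A nonzero minor makes the homology just below the top finite, hence of rank 0. A nonzero
  top cycle would be a linear relation among the columns of that minor, so there is none.\<close>

lemma hypertreesI:
  assumes "m \<ge> 1" and X: "X \<in> complexes m k" and card: "card (faces (int k) X) = (m - 1) choose k"
    and nz: "tree_sum m k (faces (int k) X) \<noteq> 0"
  shows "X \<in> hypertrees m k"
proof -
  obtain m' where m: "m = Suc m'" using assms(1) by (cases m) auto
  have T: "faces (int k) X \<subseteq> ksets m (Suc k)" by (rule faces_top_subset[OF X])
  have finT: "finite (faces (int k) X)" using T finite_ksets finite_subset by blast
  then obtain f where f: "bij_betw f (ksets m' k) (faces (int k) X)"
    using card finite_same_card_bij[of "ksets m' k" "faces (int k) X"] by (auto simp: card_ksets m)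
  have ord: "int (order (reduced_homology (int k - 1) X)) \<noteq> 0"
    using order_homology_square[OF assms(1) X card] nz by (metis zero_power2)
  have "betti (int k - 1) X = 0"
    unfolding betti_def
  proof (rule abelian_rank_finite)
    show "finite (carrier (reduced_homology (int k - 1) X))"
      using ord by (auto simp: order_def intro: card_ge_0_finite)
    show "comm_group (reduced_homology (int k - 1) X)"
    proof (rule comm_group_reduced_homology, unfold reduced_boundaries_eq, rule image_subsetI)
      fix c :: "nat set \<Rightarrow>\<^sub>0 int" assume "c \<in> {c. Poly_Mapping.keys c \<subseteq> faces (int k - 1 + 1) X}"
      then have c: "Poly_Mapping.keys c \<subseteq> ksets m (Suc k)" using T by simp
      show "face_boundary c \<in> reduced_cycles (int k - 1) X"
        unfolding reduced_cycles_eq faces_below[OF X]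
        using keys_face_boundary[OF c] face_boundary_face_boundary[OF c] by simp
    qed
  qed
  moreover have "betti (int k) X = 0"
    unfolding betti_def
  proof (rule abelian_rank_finite)
    have bd: "reduced_boundaries (int k) X = {0}"
      by (simp add: reduced_boundaries_eq faces_above[OF X] face_boundary_def)
    then show "comm_group (reduced_homology (int k) X)"
      by (intro comm_group_reduced_homology) (simp add: reduced_cycles_eq face_boundary_def)
    have "c = 0" if "c \<in> reduced_cycles (int k) X" for c
    proof (rule ccontr)
      assume "c \<noteq> 0"
      have c: "Poly_Mapping.keys c \<subseteq> faces (int k) X" "face_boundary c = 0"
        using that by (auto simp: reduced_cycles_eq)
      obtain t where t: "t \<in> Poly_Mapping.keys c" using \<open>c \<noteq> 0\<close> by (metis all_not_in_conv keys_eq_empty)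
      then obtain s where s: "s \<in> ksets m' k" "f s = t"
        using c f by (metis bij_betw_def image_iff subsetD)
      have "det_on (ksets m' k) (\<lambda>l i. bdc i (f l)) = 0"
      proof (rule det_on_eq_0_if_dependent[OF finite_ksets s(1)])
        show "Poly_Mapping.lookup c (f s) \<noteq> 0" using t s by (simp add: in_keys_iff)
        fix i
        have "(\<Sum>l\<in>ksets m' k. Poly_Mapping.lookup c (f l) * bdc i (f l)) =
            (\<Sum>t\<in>faces (int k) X. Poly_Mapping.lookup c t * bdc i t)"
          by (rule sum.reindex_bij_betw[OF f])
        also have "\<dots> = 0"
          using lookup_face_boundary[OF finT c(1), of i] c(2) by simp
        finally show "(\<Sum>l\<in>ksets m' k. Poly_Mapping.lookup c (f l) * bdc i (f l)) = 0" .
      qed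
      then show False
        using ord order_homology_eq_det[OF X[unfolded m] f] by simp
    qed
    then have "carrier (reduced_homology (int k) X) \<subseteq> {{0}}"
      unfolding carrier_reduced_homology cosets_def bd by auto
    then show "finite (carrier (reduced_homology (int k) X))"
      by (rule finite_subset) simp
  qed
  ultimately show ?thesis using X card by (simp add: hypertrees_def)
qed

lemma finite_hypertrees [simp]: "finite (hypertrees m k)"
  by (rule finite_subset[OF _ finite_complexes[of m k]]) (auto simp: hypertrees_def)

text \<open>A set \<open>T\<close> with a nonzero Cauchy-Binet term is the set of top faces of
  exactly one hypertree, since a complex is recovered from its top faces; the term of a hypertree is
  its squared torsion.\<close>

theorem sum_hypertrees:
  assumes "m \<ge> 1" and K: "K \<subseteq> ksets m (Suc k)"
  shows "(\<Sum>X | X \<in> hypertrees m k \<and> faces (int k) X \<subseteq> K.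
      int (order (reduced_homology (int k - 1) X)) ^ 2) = tree_sum m k K"
proof -
  let ?H = "{X \<in> hypertrees m k. faces (int k) X \<subseteq> K}"
  have finK: "finite K" using K finite_ksets finite_subset by blast
  have inj: "inj_on (faces (int k)) ?H"
  proof (rule inj_onI)
    fix X Y assume "X \<in> ?H" "Y \<in> ?H" and eq: "faces (int k) X = faces (int k) Y"
    then have "X \<in> complexes m k" "Y \<in> complexes m k" by (auto simp: hypertrees_def)
    then show "X = Y" using complex_eq[of X m k] complex_eq[of Y m k] eq by metis
  qed
  have "tree_sum m k K = (\<Sum>T | T \<subseteq> K \<and> card T = (m - 1) choose k. tree_sum m k T)"
    unfolding tree_sum_def using gram_det_eq_sum[OF finite_ksets finK, of "m - 1" k bdc]
    by (simp add: card_ksets)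
  also have "\<dots> = (\<Sum>T\<in>faces (int k) ` ?H. tree_sum m k T)"
  proof (rule sum.mono_neutral_right)
    show "finite {T. T \<subseteq> K \<and> card T = (m - 1) choose k}" using finK by simp
    show "faces (int k) ` ?H \<subseteq> {T. T \<subseteq> K \<and> card T = (m - 1) choose k}"
      by (auto simp: hypertrees_def)
    show "\<forall>T\<in>{T. T \<subseteq> K \<and> card T = (m - 1) choose k} - faces (int k) ` ?H. tree_sum m k T = 0"
    proof (rule ballI, rule ccontr)
      fix T assume T: "T \<in> {T. T \<subseteq> K \<and> card T = (m - 1) choose k} - faces (int k) ` ?H"
        and nz: "tree_sum m k T \<noteq> 0"
      then have TK: "T \<subseteq> ksets m (Suc k)" using K by auto
      define X where "X = full_skeleton m (int k - 1) \<union> T"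
      have X: "X \<in> complexes m k" "faces (int k) X = T"
        unfolding X_def using complexesI[OF TK] by auto
      then have "X \<in> hypertrees m k"
        using T nz by (intro hypertreesI[OF assms(1)]) auto
      then show False using T X by blast
    qed
  qed
  also have "\<dots> = (\<Sum>X\<in>?H. tree_sum m k (faces (int k) X))"
    by (simp add: sum.reindex[OF inj])
  also have "\<dots> = (\<Sum>X\<in>?H. int (order (reduced_homology (int k - 1) X)) ^ 2)"
    by (intro sum.cong refl order_homology_square[OF assms(1), symmetric]) (auto simp: hypertrees_def)
  finally show ?thesis ..
qed

section \<open>Laws of the link and of the union\<close>

definition tree_ratio :: "nat \<Rightarrow> nat \<Rightarrow> nat set set \<Rightarrow> real" where
  "tree_ratio m k K = real_of_int (tree_sum m k K) / real_of_int (tree_sum m k (ksets m (Suc k)))"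

lemma measure_hypertree_measure:
  assumes "m \<ge> 1" and prob: "prob_space (hypertree_measure m k)" and K: "K \<subseteq> ksets m (Suc k)"
  shows "measure (hypertree_measure m k) {X \<in> hypertrees m k. faces (int k) X \<subseteq> K} = tree_ratio m k K"
proof -
  let ?c = "real m ^ ((m - 2) choose k)"
  let ?w = "\<lambda>X. real (order (reduced_homology (int k - 1) X)) ^ 2 / ?c"
  have meas: "measure (hypertree_measure m k) {X \<in> hypertrees m k. faces (int k) X \<subseteq> L} =
      real_of_int (tree_sum m k L) / ?c" if L: "L \<subseteq> ksets m (Suc k)" for L
  proof -
    let ?H = "{X \<in> hypertrees m k. faces (int k) X \<subseteq> L}"
    have "emeasure (hypertree_measure m k) ?H = (\<Sum>X\<in>?H. ennreal (?w X))"
      unfolding hypertree_measure_def by (rule emeasure_point_measure_finite) auto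
    also have "\<dots> = ennreal (\<Sum>X\<in>?H. ?w X)"
      by (rule sum_ennreal) simp
    also have "(\<Sum>X\<in>?H. ?w X) = real_of_int (tree_sum m k L) / ?c"
      unfolding sum_hypertrees[OF assms(1) L, symmetric] by (simp add: sum_divide_distrib)
    finally have eq: "emeasure (hypertree_measure m k) ?H = ennreal (real_of_int (tree_sum m k L) / ?c)" .
    have "0 \<le> (\<Sum>X\<in>?H. ?w X)" by (intro sum_nonneg) simp
    then have "0 \<le> real_of_int (tree_sum m k L) / ?c"
      unfolding sum_hypertrees[OF assms(1) L, symmetric] by (simp add: sum_divide_distrib)
    then show ?thesis unfolding measure_def eq by simp
  qed
  have sp: "{X \<in> hypertrees m k. faces (int k) X \<subseteq> ksets m (Suc k)} = space (hypertree_measure m k)"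
    using faces_top_subset by (auto simp: hypertree_measure_def hypertrees_def space_point_measure)
  \<comment> \<open>Total mass 1 identifies the total weight with the normalising power of
    \<open>m\<close>.\<close>
  have "real_of_int (tree_sum m k (ksets m (Suc k))) / ?c = 1"
    unfolding meas[OF order_refl, symmetric] sp by (rule prob_space.prob_space[OF prob])
  then have "real_of_int (tree_sum m k (ksets m (Suc k))) = ?c"
    by (cases "?c = 0") simp_all
  then show ?thesis using meas[OF K] by (simp add: tree_ratio_def)
qed

lemma ksets_minus_cylinder:
  "ksets (Suc m) (Suc k) - cylinder (Suc m) (Suc k) {Suc m} L = insert (Suc m) ` (ksets m k - L)"
proof (intro equalityI subsetI)
  fix \<tau> assume "\<tau> \<in> ksets (Suc m) (Suc k) - cylinder (Suc m) (Suc k) {Suc m} L"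
  then have \<tau>: "\<tau> \<in> ksets (Suc m) (Suc k)" "Suc m \<in> \<tau>" "\<tau> - {Suc m} \<notin> L"
    by (auto simp: cylinder_def)
  then have "\<tau> \<in> insert (Suc m) ` ksets m k"
    using bij_betw_insert_ksets[of m k] by (simp add: bij_betw_def)
  then obtain l where l: "l \<in> ksets m k" "\<tau> = insert (Suc m) l" by blast
  then have "\<tau> - {Suc m} = l" using not_mem_ksets by auto
  then show "\<tau> \<in> insert (Suc m) ` (ksets m k - L)" using l \<tau>(3) by blast
next
  fix \<tau> assume "\<tau> \<in> insert (Suc m) ` (ksets m k - L)"
  then obtain l where l: "l \<in> ksets m k" "l \<notin> L" "\<tau> = insert (Suc m) l" by blast
  then have "\<tau> - {Suc m} = l" using not_mem_ksets by auto
  moreover have "\<tau> \<in> ksets (Suc m) (Suc k)"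
    using bij_betw_insert_ksets[of m k] l by (auto simp: bij_betw_def)
  ultimately show "\<tau> \<in> ksets (Suc m) (Suc k) - cylinder (Suc m) (Suc k) {Suc m} L"
    using l by (auto simp: cylinder_def)
qed

text \<open>Coning preserves the number of forbidden faces, so the exponent is the same at every
  stage of the iteration.\<close>

lemma card_ksets_minus_cylinder:
  "card (ksets (Suc m) (Suc k) - cylinder (Suc m) (Suc k) {Suc m} L) = card (ksets m k - L)"
  unfolding ksets_minus_cylinder
  by (rule card_image, rule inj_on_subset[OF bij_betw_imp_inj_on[OF bij_betw_insert_ksets[of m k]]])
    auto

text \<open>Dividing \<open>tree_sum_cylinder\<close> for \<open>L\<close> by its instance for the
  set of all faces cancels the constant \<open>?c\<close>; each face missing from \<open>L\<close>
  leaves one factor \<open>m / (m + 1)\<close>.\<close>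

lemma tree_ratio_cylinder:
  assumes m: "m \<ge> 1" and L: "L \<subseteq> ksets m (Suc k)"
  shows "tree_ratio (Suc m) (Suc k) (cylinder (Suc m) (Suc (Suc k)) {Suc m} L) =
    (real m / real (Suc m)) ^ card (ksets m (Suc k) - L) * tree_ratio m k L"
proof -
  let ?S = "ksets m (Suc k)"
  let ?c = "real (Suc m) ^ card (ksets (m - 1) k) * real_of_int (tree_sum m k ?S)"
  have all: "cylinder (Suc m) (Suc (Suc k)) {Suc m} ?S = ksets (Suc m) (Suc (Suc k))"
    using ksets_minus_cylinder[of m "Suc k" ?S] by (auto simp: cylinder_def)
  have pos: "tree_sum m k ?S > 0" "tree_sum (Suc m) (Suc k) (ksets (Suc m) (Suc (Suc k))) > 0"
    using m by (auto intro: tree_sum_pos)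
  then have c: "?c \<noteq> 0" by simp
  have card: "card ?S = card L + card (?S - L)"
    using L finite_subset[OF L] by (simp add: card_Diff_subset card_mono)
  have eq: "?c * real_of_int (tree_sum (Suc m) (Suc k) (cylinder (Suc m) (Suc (Suc k)) {Suc m} K)) =
      real (Suc m) ^ card K * real m ^ card (?S - K) * real_of_int (tree_sum m k K)"
    if "K \<subseteq> ?S" for K
    using arg_cong[OF tree_sum_cylinder[OF m that], of real_of_int] by simp
  have "tree_ratio (Suc m) (Suc k) (cylinder (Suc m) (Suc (Suc k)) {Suc m} L) =
      (?c * real_of_int (tree_sum (Suc m) (Suc k) (cylinder (Suc m) (Suc (Suc k)) {Suc m} L))) /
      (?c * real_of_int (tree_sum (Suc m) (Suc k) (cylinder (Suc m) (Suc (Suc k)) {Suc m} ?S)))"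
    unfolding tree_ratio_def all by (rule mult_divide_mult_cancel_left[OF c, symmetric])
  also have "\<dots> = (real (Suc m) ^ card L * real m ^ card (?S - L) * real_of_int (tree_sum m k L)) /
      (real (Suc m) ^ card ?S * real_of_int (tree_sum m k ?S))"
    unfolding eq[OF L] eq[OF order_refl] by simp
  also have "\<dots> = (real m / real (Suc m)) ^ card (?S - L) * tree_ratio m k L"
    unfolding card power_add tree_ratio_def power_divide using pos by (simp add: field_simps)
  finally show ?thesis .
qed

text \<open>One vertex is peeled off at a time: the cylinder for \<open>{m + 1..m + j + 1}\<close>
  is a cylinder at the last vertex over the cylinder for \<open>{m + 1..m + j}\<close>. The second
  conclusion is carried along because it supplies the exponent of each new factor.\<close>

lemma tree_ratio_iterated_cylinder:
  assumes m: "m \<ge> 1" and L: "L \<subseteq> ksets m (Suc i)"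
  shows "tree_ratio (m + j) (i + j) (cylinder (m + j) (Suc (i + j)) {m + 1..m + j} L) =
      (real m / real (m + j)) ^ card (ksets m (Suc i) - L) * tree_ratio m i L"
    and "card (ksets (m + j) (Suc (i + j)) - cylinder (m + j) (Suc (i + j)) {m + 1..m + j} L) =
      card (ksets m (Suc i) - L)"
proof (induction j)
  case 0
  have "cylinder m (Suc i) {} L = L" using L by (auto simp: cylinder_def)
  then show "tree_ratio (m + 0) (i + 0) (cylinder (m + 0) (Suc (i + 0)) {m + 1..m + 0} L) =
      (real m / real (m + 0)) ^ card (ksets m (Suc i) - L) * tree_ratio m i L"
    and "card (ksets (m + 0) (Suc (i + 0)) - cylinder (m + 0) (Suc (i + 0)) {m + 1..m + 0} L) =
      card (ksets m (Suc i) - L)"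
    using m by simp_all
next
  case (Suc j)
  let ?n = "m + j" and ?k = "i + j"
  let ?C = "cylinder ?n (Suc ?k) {m + 1..?n} L"
  have C: "?C \<subseteq> ksets ?n (Suc ?k)" by (auto simp: cylinder_def)
  have n: "?n \<ge> 1" using m by simp
  have "cylinder (m + Suc j) (Suc (i + Suc j)) {m + 1..m + Suc j} L =
      cylinder (Suc ?n) (Suc (Suc ?k)) {Suc ?n} ?C"
  proof -
    have "\<tau> \<in> cylinder (Suc ?n) (Suc (Suc ?k)) {m + 1..Suc ?n} L \<longleftrightarrow>
        \<tau> \<in> cylinder (Suc ?n) (Suc (Suc ?k)) {Suc ?n} ?C" for \<tau>
    proof (cases "\<tau> \<in> ksets (Suc ?n) (Suc (Suc ?k)) \<and> Suc ?n \<in> \<tau>")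
      case True
      have "\<tau> - {Suc ?n} \<in> ksets ?n (Suc ?k)"
        using remove_mem_ksets[of \<tau> "Suc ?n" "Suc ?k" "Suc ?n"] True
          ksets_Suc_avoid[of ?n "Suc ?k"] by auto
      moreover have "{m + 1..Suc ?n} = insert (Suc ?n) {m + 1..?n}" by auto
      moreover have "insert (Suc ?n) {m + 1..?n} \<subseteq> \<tau> \<longleftrightarrow> {m + 1..?n} \<subseteq> \<tau> - {Suc ?n}"
        using True by auto
      moreover have "\<tau> - insert (Suc ?n) {m + 1..?n} = \<tau> - {Suc ?n} - {m + 1..?n}" by auto
      ultimately show ?thesis using True by (simp add: cylinder_def)
    next
      case False
      have "Suc ?n \<in> {m + 1..Suc ?n}" by simp
      then show ?thesis using False unfolding cylinder_def by blast
    qed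
    then show ?thesis by auto
  qed
  note eq = this
  have card: "card (ksets ?n (Suc ?k) - ?C) = card (ksets m (Suc i) - L)" by (rule Suc.IH)
  show "card (ksets (m + Suc j) (Suc (i + Suc j)) - cylinder (m + Suc j) (Suc (i + Suc j)) {m + 1..m + Suc j} L) =
      card (ksets m (Suc i) - L)"
    unfolding eq using card_ksets_minus_cylinder[of ?n "Suc ?k" ?C] card by simp
  have "real ?n \<noteq> 0" using n by simp
  then have "(real ?n / real (Suc ?n)) * (real m / real ?n) = real m / real (m + Suc j)"
    by simp
  then show "tree_ratio (m + Suc j) (i + Suc j) (cylinder (m + Suc j) (Suc (i + Suc j)) {m + 1..m + Suc j} L) =
      (real m / real (m + Suc j)) ^ card (ksets m (Suc i) - L) * tree_ratio m i L"
    unfolding eq using tree_ratio_cylinder[OF n C] Suc.IH(1) card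
    by (simp add: power_mult_distrib[symmetric] mult.assoc[symmetric] del: of_nat_Suc of_nat_add)
qed

text \<open>Lying inside \<open>L\<close> means that every face outside \<open>L\<close> is absent,
  and these absences are independent, each of probability \<open>1 - p\<close>.\<close>

lemma linial_meshulam_subset:
  assumes p: "0 \<le> p" "p \<le> 1" and L: "L \<subseteq> ksets m (Suc i)"
  shows "measure_pmf.prob (linial_meshulam m i p) {Y. faces (int i) Y \<subseteq> L} =
    (1 - p) ^ card (ksets m (Suc i) - L)"
proof -
  let ?E = "ksets m (Suc i)"
  define B where "B \<sigma> = (if \<sigma> \<in> L then UNIV else {False})" for \<sigma> :: "nat set"
  have vimage: "(\<lambda>included. full_skeleton m (int i - 1) \<union> {\<sigma> \<in> ?E. included \<sigma>}) -`
      {Y. faces (int i) Y \<subseteq> L} = Pi ?E B"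
  proof -
    have "faces (int i) (full_skeleton m (int i - 1) \<union> {\<sigma> \<in> ?E. included \<sigma>}) = {\<sigma> \<in> ?E. included \<sigma>}"
      for included by (rule complexesI(2)) auto
    then show ?thesis by (auto simp: B_def Pi_def)
  qed
  have "measure_pmf.prob (linial_meshulam m i p) {Y. faces (int i) Y \<subseteq> L} =
      measure_pmf.prob (Pi_pmf ?E False (\<lambda>_. bernoulli_pmf p)) (Pi ?E B)"
    unfolding linial_meshulam_def faces_Pow measure_map_pmf vimage ..
  also have "\<dots> = (\<Prod>\<sigma>\<in>?E. measure_pmf.prob (bernoulli_pmf p) (B \<sigma>))"
    by (rule measure_Pi_pmf_Pi) simp
  also have "\<dots> = (\<Prod>\<sigma>\<in>?E. if \<sigma> \<in> L then 1 else 1 - p)"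
  proof (rule prod.cong[OF refl])
    fix \<sigma>
    have "measure_pmf.prob (bernoulli_pmf p) {False} = 1 - p"
      using p by (simp add: measure_pmf_single)
    then show "measure_pmf.prob (bernoulli_pmf p) (B \<sigma>) = (if \<sigma> \<in> L then 1 else 1 - p)"
      by (simp add: B_def)
  qed
  also have "\<dots> = (\<Prod>\<sigma>\<in>?E - L. 1 - p)"
    by (rule prod.mono_neutral_cong_right) auto
  finally show ?thesis by simp
qed

section \<open>Laws of random subfamilies of a finite set\<close>

lemma (in prob_space) prob_subset_eq_sum:
  assumes h: "h \<in> measurable M (count_space UNIV)" and "finite L"
  shows "prob {\<omega> \<in> space M. h \<omega> \<subseteq> L} = (\<Sum>G\<in>Pow L. prob {\<omega> \<in> space M. h \<omega> = G})"
proof -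
  have "{\<omega> \<in> space M. h \<omega> \<subseteq> L} = (\<Union>G\<in>Pow L. {\<omega> \<in> space M. h \<omega> = G})" by auto
  moreover have "prob (\<Union>G\<in>Pow L. {\<omega> \<in> space M. h \<omega> = G}) =
      (\<Sum>G\<in>Pow L. prob {\<omega> \<in> space M. h \<omega> = G})"
  proof (rule finite_measure_finite_Union)
    have "{\<omega> \<in> space M. h \<omega> = G} \<in> events" for G
      using measurable_sets[OF h, of "{G}"] by (simp add: vimage_def Int_def conj_commute)
    then show "(\<lambda>G. {\<omega> \<in> space M. h \<omega> = G}) ` Pow L \<subseteq> events" by blast
    show "finite (Pow L)" using assms(2) by simp
  qed (auto simp: disjoint_family_on_def)
  ultimately show ?thesis by simp
qed

text \<open>Moebius inversion on the subset lattice, done by induction: in the sum over all subsets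
  of \<open>F\<close> the terms for proper subsets agree, so the term for \<open>F\<close> does
  too.\<close>

lemma prob_eq_if_prob_subset_eq:
  assumes M: "prob_space M" "f \<in> measurable M (count_space UNIV)"
    and N: "prob_space N" "g \<in> measurable N (count_space UNIV)"
    and eq: "\<And>L. L \<subseteq> E \<Longrightarrow> measure M {\<omega> \<in> space M. f \<omega> \<subseteq> L} = measure N {\<omega> \<in> space N. g \<omega> \<subseteq> L}"
    and F: "finite E" "F \<subseteq> E"
  shows "measure M {\<omega> \<in> space M. f \<omega> = F} = measure N {\<omega> \<in> space N. g \<omega> = F}"
proof -
  have "finite F" using F finite_subset by blast
  then show ?thesis using F(2)
  proof (induction F rule: finite_psubset_induct)
    case (psubset F)
    have P: "Pow F = insert F {G. G \<subset> F}" by auto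
    have fin: "finite {G. G \<subset> F}" using psubset(1) by (rule rev_finite_subset[OF finite_Pow_iff[THEN iffD2]]) auto
    have "(\<Sum>G\<in>Pow F. measure M {\<omega> \<in> space M. f \<omega> = G}) = (\<Sum>G\<in>Pow F. measure N {\<omega> \<in> space N. g \<omega> = G})"
      using eq[OF psubset.prems] prob_space.prob_subset_eq_sum[OF M(1,2) psubset(1)]
        prob_space.prob_subset_eq_sum[OF N(1,2) psubset(1)] by simp
    moreover have "(\<Sum>G | G \<subset> F. measure M {\<omega> \<in> space M. f \<omega> = G}) =
        (\<Sum>G | G \<subset> F. measure N {\<omega> \<in> space N. g \<omega> = G})"
      using psubset by (intro sum.cong refl psubset.IH) auto
    ultimately show ?case unfolding P using fin by simp
  qed
qed

text \<open>Containment in \<open>E\<close> is only almost sure, since a variable with the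
  Linial-Meshulam law can take arbitrary values on a null set.\<close>

lemma distr_eq_if_prob_subset_eq:
  assumes E: "finite E"
    and M: "prob_space M" "f \<in> measurable M (count_space UNIV)" "AE \<omega> in M. f \<omega> \<subseteq> E"
    and N: "prob_space N" "g \<in> measurable N (count_space UNIV)" "AE \<omega> in N. g \<omega> \<subseteq> E"
    and eq: "\<And>L. L \<subseteq> E \<Longrightarrow> measure M {\<omega> \<in> space M. f \<omega> \<subseteq> L} = measure N {\<omega> \<in> space N. g \<omega> \<subseteq> L}"
  shows "distr M (count_space UNIV) f = distr N (count_space UNIV) g"
proof (rule measure_eqI_countable_AE[where \<Omega> = "Pow E"])
  show "AE x in distr M (count_space UNIV) f. x \<in> Pow E"
    using M(2,3) by (subst AE_distr_iff) auto
  show "AE x in distr N (count_space UNIV) g. x \<in> Pow E"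
    using N(2,3) by (subst AE_distr_iff) auto
  show "countable (Pow E)" using E by (simp add: countable_finite)
  fix F assume "F \<in> Pow E"
  then have "measure M {\<omega> \<in> space M. f \<omega> = F} = measure N {\<omega> \<in> space N. g \<omega> = F}"
    using prob_eq_if_prob_subset_eq[OF M(1,2) N(1,2) eq E] by simp
  moreover have "f -` {F} \<inter> space M = {\<omega> \<in> space M. f \<omega> = F}"
    "g -` {F} \<inter> space N = {\<omega> \<in> space N. g \<omega> = F}" by auto
  ultimately show "emeasure (distr M (count_space UNIV) f) {F} = emeasure (distr N (count_space UNIV) g) {F}"
    using M(1,2) N(1,2)
    by (simp add: emeasure_distr finite_measure.emeasure_eq_measure prob_space.finite_measure)
qed auto

text \<open>Joining \<open>{m + 1..m + j}\<close> to a face on \<open>{1..m}\<close> adds exactly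
  \<open>j\<close> elements, so both skeleton bounds on \<open>X\<close> become bounds in dimension
  \<open>i\<close> on \<open>m\<close> vertices. The link is thus determined by its
  \<open>i\<close>-faces, and confining these to \<open>L\<close> is a cylinder condition on
  \<open>X\<close>.\<close>

lemma Link_complex:
  assumes X: "X \<in> complexes (m + j) (i + j)"
  shows "Link (m + j) {m + 1..m + j} X =
      full_skeleton m (int i - 1) \<union> faces (int i) (Link (m + j) {m + 1..m + j} X)"
    and "faces (int i) (Link (m + j) {m + 1..m + j} X) \<subseteq> ksets m (Suc i)"
    and "L \<subseteq> ksets m (Suc i) \<Longrightarrow> faces (int i) (Link (m + j) {m + 1..m + j} X) \<subseteq> L \<longleftrightarrow>
      faces (int (i + j)) X \<subseteq> cylinder (m + j) (Suc (i + j)) {m + 1..m + j} L"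
proof -
  let ?\<sigma> = "{m + 1..m + j}"
  let ?K = "Link (m + j) ?\<sigma> X"
  have diff: "{1..m + j} - ?\<sigma> = {1..m}" by auto
  have card: "card (\<tau> \<union> ?\<sigma>) = card \<tau> + j" if "\<tau> \<subseteq> {1..m}" for \<tau>
  proof -
    have "finite \<tau>" using that finite_subset by blast
    moreover have "\<tau> \<inter> ?\<sigma> = {}" using that by fastforce
    ultimately show ?thesis by (simp add: card_Un_disjoint)
  qed
  have K: "\<tau> \<in> ?K \<longleftrightarrow> \<tau> \<subseteq> {1..m} \<and> \<tau> \<union> ?\<sigma> \<in> X" for \<tau>
    unfolding Link_def diff by simp
  have X': "full_skeleton (m + j) (int (i + j) - 1) \<subseteq> X" "X \<subseteq> full_skeleton (m + j) (int (i + j))"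
    using X by (auto simp: complexes_def)
  have low: "full_skeleton m (int i - 1) \<subseteq> ?K"
  proof
    fix \<tau> assume "\<tau> \<in> full_skeleton m (int i - 1)"
    then have \<tau>: "\<tau> \<subseteq> {1..m}" "card \<tau> \<le> i" by (auto simp: full_skeleton_def)
    moreover have "{1..m} \<union> ?\<sigma> \<subseteq> {1..m + j}" by auto
    ultimately have "\<tau> \<union> ?\<sigma> \<in> full_skeleton (m + j) (int (i + j) - 1)"
      using card[OF \<tau>(1)] unfolding full_skeleton_def by auto
    then show "\<tau> \<in> ?K" using X'(1) \<tau>(1) K by blast
  qed
  have high: "card \<tau> \<le> Suc i" if "\<tau> \<in> ?K" for \<tau>
  proof -
    have "\<tau> \<subseteq> {1..m}" "\<tau> \<union> ?\<sigma> \<in> full_skeleton (m + j) (int (i + j))"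
      using that K X'(2) by blast+
    then show ?thesis using card[of \<tau>] unfolding full_skeleton_def by auto
  qed
  have faces: "faces (int i) ?K = {\<tau> \<in> ?K. card \<tau> = Suc i}" by (simp add: faces_def)
  show "?K = full_skeleton m (int i - 1) \<union> faces (int i) ?K"
  proof (intro equalityI subsetI)
    fix \<tau> assume \<tau>: "\<tau> \<in> ?K"
    then have "card \<tau> \<le> i \<or> card \<tau> = Suc i" "\<tau> \<subseteq> {1..m}" using high[OF \<tau>] K by auto
    then show "\<tau> \<in> full_skeleton m (int i - 1) \<union> faces (int i) ?K"
      using \<tau> by (auto simp only: full_skeleton_def faces int_card_eq_dim)
  qed (use low in \<open>auto simp: faces_def\<close>)
  show "faces (int i) ?K \<subseteq> ksets m (Suc i)"
    unfolding faces ksets_def using K by blast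
  assume L: "L \<subseteq> ksets m (Suc i)"
  show "faces (int i) ?K \<subseteq> L \<longleftrightarrow>
      faces (int (i + j)) X \<subseteq> cylinder (m + j) (Suc (i + j)) ?\<sigma> L"
  proof (intro iffI subsetI)
    fix \<tau> assume sub: "faces (int i) ?K \<subseteq> L" and \<tau>: "\<tau> \<in> faces (int (i + j)) X"
    have \<tau>': "\<tau> \<in> ksets (m + j) (Suc (i + j))" "\<tau> \<in> X"
      using faces_top_subset[OF X] \<tau> by (auto simp: faces_def)
    have "\<tau> - ?\<sigma> \<in> L" if "?\<sigma> \<subseteq> \<tau>"
    proof -
      have sub\<tau>: "\<tau> - ?\<sigma> \<subseteq> {1..m}" using \<tau>'(1) diff by (auto simp: ksets_def)
      have un: "\<tau> - ?\<sigma> \<union> ?\<sigma> = \<tau>" using that by auto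
      have "card (\<tau> - ?\<sigma>) = Suc i"
        using card[OF sub\<tau>] \<tau>'(1) unfolding un by (auto simp: ksets_def)
      moreover have "\<tau> - ?\<sigma> \<in> ?K" using K un sub\<tau> \<tau>'(2) by simp
      ultimately show ?thesis using sub faces by blast
    qed
    then show "\<tau> \<in> cylinder (m + j) (Suc (i + j)) ?\<sigma> L" using \<tau>' by (simp add: cylinder_def)
  next
    fix \<tau> assume sub: "faces (int (i + j)) X \<subseteq> cylinder (m + j) (Suc (i + j)) ?\<sigma> L"
      and "\<tau> \<in> faces (int i) ?K"
    then have \<tau>: "\<tau> \<subseteq> {1..m}" "\<tau> \<union> ?\<sigma> \<in> X" "card \<tau> = Suc i" using faces K by auto
    then have "\<tau> \<union> ?\<sigma> \<in> faces (int (i + j)) X" using card[OF \<tau>(1)] by (simp add: faces_def)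
    then have "\<tau> \<union> ?\<sigma> - ?\<sigma> \<in> L" using sub unfolding cylinder_def by blast
    moreover have "\<tau> \<union> ?\<sigma> - ?\<sigma> = \<tau>" using \<tau>(1) by fastforce
    ultimately show "\<tau> \<in> L" by simp
  qed
qed

lemma prob_law_vimage:
  assumes "has_law M X P" "A \<in> sets P"
  shows "measure M (X -` A \<inter> space M) = measure P A"
  using assms measure_distr[of X M P A] by (simp add: has_law_def)

text \<open>Applied to a variable with the hypertree law, this makes
  \<open>hypertree_measure\<close> a probability measure, which fixes the total weight.\<close>

lemma prob_space_law:
  assumes "prob_space M" "has_law M X P"
  shows "prob_space P"
  using prob_space.prob_space_distr[OF assms(1), of X P] assms(2) by (simp add: has_law_def)

lemma prob_hypertree_subset:
  assumes "m \<ge> 1" "prob_space M" and law: "has_law M T (hypertree_measure m k)"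
    and K: "K \<subseteq> ksets m (Suc k)"
  shows "measure M (T -` {X \<in> hypertrees m k. faces (int k) X \<subseteq> K} \<inter> space M) = tree_ratio m k K"
proof -
  have "{X \<in> hypertrees m k. faces (int k) X \<subseteq> K} \<in> sets (hypertree_measure m k)"
    by (auto simp: hypertree_measure_def sets_point_measure)
  from prob_law_vimage[OF law this] show ?thesis
    unfolding measure_hypertree_measure[OF assms(1) prob_space_law[OF assms(2) law] K] .
qed

lemma law_mem_hypertrees:
  assumes "has_law M T (hypertree_measure m k)" "\<omega> \<in> space M"
  shows "T \<omega> \<in> hypertrees m k"
  using assms measurable_space[of T M "hypertree_measure m k" \<omega>]
  by (simp add: has_law_def hypertree_measure_def space_point_measure)

lemma law_measurable_compose:
  assumes "has_law M T (hypertree_measure m k)"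
  shows "(\<lambda>\<omega>. h (T \<omega>)) \<in> measurable M (count_space UNIV)"
  using assms by (intro measurable_compose[of T M "hypertree_measure m k" h])
    (auto simp: has_law_def hypertree_measure_def)

theorem theorem1p2:
  fixes n k j :: nat
    and M :: "'a measure" and T :: "'a \<Rightarrow> nat set set"
    and N :: "'b measure" and S Y :: "'b \<Rightarrow> nat set set"
  assumes "1 \<le> j" and "j \<le> k" and "k < n - 1"
    and "prob_space M"
    and "has_law M T (hypertree_measure n k)"
    and "prob_space N"
    and "has_law N S (hypertree_measure (n - j) (k - j))"
    and "has_law N Y (measure_pmf (linial_meshulam (n - j) (k - j) (real j / real n)))"
    and "prob_space.indep_var N
           (hypertree_measure (n - j) (k - j)) S
           (measure_pmf (linial_meshulam (n - j) (k - j) (real j / real n))) Y"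
  shows "distr M (count_space UNIV) (\<lambda>\<omega>. Link n {n - j + 1..n} (T \<omega>)) =
         distr N (count_space UNIV) (\<lambda>\<omega>. complex_union (n - j) (k - j) (S \<omega>) (Y \<omega>))"
proof -
  define m i where "m = n - j" and "i = k - j"
  have n: "n = m + j" and k: "k = i + j" and m: "m \<ge> 1"
    using assms(1-3) by (auto simp: m_def i_def)
  note M = \<open>prob_space M\<close> and N = \<open>prob_space N\<close>
  have T: "has_law M T (hypertree_measure (m + j) (i + j))" using assms(5) n k by simp
  note S = assms(7)[folded m_def i_def]
  let ?LM = "linial_meshulam m i (real j / real n)"
  note Y = assms(8)[folded m_def i_def] and indep = assms(9)[folded m_def i_def]
  let ?\<sigma> = "{m + 1..m + j}"
  let ?E = "ksets m (Suc i)"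
  \<comment> \<open>Both complexes consist of the full skeleton and their \<open>i\<close>-faces, so
    it is enough to compare the random families \<open>F\<close> and \<open>G\<close>.\<close>
  define F where "F \<omega> = faces (int i) (Link (m + j) ?\<sigma> (T \<omega>))" for \<omega>
  define G where "G \<omega> = faces (int i) (S \<omega>) \<union> faces (int i) (Y \<omega>)" for \<omega>
  have T_complex: "T \<omega> \<in> complexes (m + j) (i + j)" if "\<omega> \<in> space M" for \<omega>
    using law_mem_hypertrees[OF T that] by (simp add: hypertrees_def)
  have S_complex: "S \<omega> \<in> complexes m i" if "\<omega> \<in> space N" for \<omega>
    using law_mem_hypertrees[OF S that] by (simp add: hypertrees_def)
  have F_meas: "F \<in> measurable M (count_space UNIV)"
    unfolding F_def[abs_def] by (rule law_measurable_compose[OF T])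
  have G_meas: "G \<in> measurable N (count_space UNIV)"
    unfolding G_def[abs_def]
  \<comment> \<open>\<open>G\<close> depends on two variables; splitting over the finitely many
    values of \<open>S\<close> reduces its measurability to that of functions of \<open>Y\<close>
    alone.\<close>
  proof (rule measurable_compose_countable'[where I = "hypertrees m i" and g = S])
    show "(\<lambda>\<omega>. faces (int i) X \<union> faces (int i) (Y \<omega>)) \<in> measurable N (count_space UNIV)" for X
      by (rule measurable_compose[of Y N "measure_pmf ?LM" "\<lambda>y. faces (int i) X \<union> faces (int i) y"])
        (use Y in \<open>auto simp: has_law_def\<close>)
    have "measurable N (hypertree_measure m i) = measurable N (count_space (hypertrees m i))"
      by (rule measurable_cong_sets) (simp_all add: hypertree_measure_def sets_point_measure_count_space)
    then show "S \<in> measurable N (count_space (hypertrees m i))"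
      using S by (simp add: has_law_def)
  qed (simp add: countable_finite)
  have Y_AE: "AE \<omega> in N. faces (int i) (Y \<omega>) \<subseteq> ?E"
  proof -
    have AE_LM: "AE y in measure_pmf ?LM. faces (int i) y \<subseteq> ?E"
    proof (rule AE_pmfI)
      fix y assume "y \<in> set_pmf ?LM"
      then obtain inc where y: "y = full_skeleton m (int i - 1) \<union> {\<sigma> \<in> ?E. inc \<sigma>}"
        unfolding linial_meshulam_def faces_Pow set_map_pmf by blast
      have "faces (int i) y = {\<sigma> \<in> ?E. inc \<sigma>}" unfolding y by (rule complexesI(2)) auto
      then show "faces (int i) y \<subseteq> ?E" by auto
    qed
    have law: "Y \<in> measurable N (measure_pmf ?LM)" "distr N (measure_pmf ?LM) Y = measure_pmf ?LM"
      using Y unfolding has_law_def by blast+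
    show ?thesis
      by (rule AE_distrD[OF law(1), unfolded law(2)]) (rule AE_LM)
  qed
  have "distr M (count_space UNIV) F = distr N (count_space UNIV) G"
  proof (rule distr_eq_if_prob_subset_eq[OF finite_ksets M F_meas _ N G_meas])
    show "AE \<omega> in M. F \<omega> \<subseteq> ?E"
      using Link_complex(2)[OF T_complex] by (intro AE_I2) (simp add: F_def)
    show "AE \<omega> in N. G \<omega> \<subseteq> ?E"
      using Y_AE
    proof (rule AE_mp[OF _ AE_I2], intro impI)
      fix \<omega> assume "\<omega> \<in> space N" "faces (int i) (Y \<omega>) \<subseteq> ?E"
      then show "G \<omega> \<subseteq> ?E" using faces_top_subset[OF S_complex] by (simp add: G_def)
    qed
    fix L assume L: "L \<subseteq> ?E"
    let ?C = "cylinder (m + j) (Suc (i + j)) ?\<sigma> L"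
    have C: "?C \<subseteq> ksets (m + j) (Suc (i + j))" by (auto simp: cylinder_def)
    have F_event: "{\<omega> \<in> space M. F \<omega> \<subseteq> L} =
        T -` {X \<in> hypertrees (m + j) (i + j). faces (int (i + j)) X \<subseteq> ?C} \<inter> space M"
      using Link_complex(3)[OF T_complex L] law_mem_hypertrees[OF T] by (auto simp: F_def)
    have "measure M {\<omega> \<in> space M. F \<omega> \<subseteq> L} = tree_ratio (m + j) (i + j) ?C"
      unfolding F_event by (rule prob_hypertree_subset[OF _ M T C]) (use m in simp)
    also have "\<dots> = (real m / real n) ^ card (?E - L) * tree_ratio m i L"
      unfolding n by (rule tree_ratio_iterated_cylinder(1)[OF m L])
    also have "\<dots> = measure N {\<omega> \<in> space N. G \<omega> \<subseteq> L}"
    proof -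
      let ?A = "{X \<in> hypertrees m i. faces (int i) X \<subseteq> L}"
      let ?B = "{y. faces (int i) y \<subseteq> L}"
      \<comment> \<open>A union lies in \<open>L\<close> exactly if both parts do, so independence
        turns the probability into a product.\<close>
      have G_event: "{\<omega> \<in> space N. G \<omega> \<subseteq> L} = (\<lambda>\<omega>. (S \<omega>, Y \<omega>)) -` (?A \<times> ?B) \<inter> space N"
        using law_mem_hypertrees[OF S] by (auto simp: G_def)
      have "measure N {\<omega> \<in> space N. G \<omega> \<subseteq> L} =
          measure N (S -` ?A \<inter> space N) * measure N (Y -` ?B \<inter> space N)"
        unfolding G_event
        by (rule prob_space.indep_varD[OF N indep]) (auto simp: hypertree_measure_def sets_point_measure)
      also have "measure N (S -` ?A \<inter> space N) = tree_ratio m i L"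
        by (rule prob_hypertree_subset[OF m N S L])
      also have "measure N (Y -` ?B \<inter> space N) = measure_pmf.prob ?LM ?B"
        by (rule prob_law_vimage[OF Y]) simp
      also have "\<dots> = (1 - real j / real n) ^ card (?E - L)"
        by (rule linial_meshulam_subset[OF _ _ L]) (use m in \<open>simp_all add: n divide_le_eq\<close>)
      \<comment> \<open>The probability of absence equals the telescoped base \<open>m / n\<close>;
        this is where the parameter \<open>j / n\<close> comes from.\<close>
      also have "1 - real j / real n = real m / real n"
        using m by (simp add: n field_simps)
      finally show ?thesis by (simp add: mult.commute)
    qed
    finally show "measure M {\<omega> \<in> space M. F \<omega> \<subseteq> L} = measure N {\<omega> \<in> space N. G \<omega> \<subseteq> L}" .
  qed
  \<comment> \<open>Adding the fixed skeleton is a function of the family of \<open>i\<close>-faces,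
    so equality of laws passes to the complexes.\<close>
  then have "distr (distr M (count_space UNIV) F) (count_space UNIV) ((\<union>) (full_skeleton m (int i - 1))) =
      distr (distr N (count_space UNIV) G) (count_space UNIV) ((\<union>) (full_skeleton m (int i - 1)))"
    by simp
  then have "distr M (count_space UNIV) (\<lambda>\<omega>. full_skeleton m (int i - 1) \<union> F \<omega>) =
      distr N (count_space UNIV) (\<lambda>\<omega>. full_skeleton m (int i - 1) \<union> G \<omega>)"
    using F_meas G_meas by (simp add: distr_distr o_def)
  moreover have "distr M (count_space UNIV) (\<lambda>\<omega>. full_skeleton m (int i - 1) \<union> F \<omega>) =
      distr M (count_space UNIV) (\<lambda>\<omega>. Link n {n - j + 1..n} (T \<omega>))"
    using Link_complex(1)[OF T_complex] by (intro distr_cong refl) (simp add: F_def n)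
  moreover have "(\<lambda>\<omega>. full_skeleton m (int i - 1) \<union> G \<omega>) =
      (\<lambda>\<omega>. complex_union (n - j) (k - j) (S \<omega>) (Y \<omega>))"
    by (simp add: complex_union_def G_def n k)
  ultimately show ?thesis by simp
qed

end
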